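(* Let $b\in\{N,D\}$, $T>0$, and assume $\delta+1<\frac1\gamma$. Then for every $x\in F$ and $t\in[0,T]$, $$\int_0^1\Big(\big\langle P_b(t,\cdot,y),f_n^x\big\rangle_\mu-P_b(t,x,y)\Big)^2d\mu(y)\longrightarrow 0\qquad\text{as } n\to\infty.$$
   Context: Let $N\ge 2$ and $S_i:[0,1]\to[0,1]$, $S_i(x)=r_ix+b_i$, $0<r_i<1$, $0\le b_i\le 1-r_i$, $i=1,\dots,N$, with $0=S_1(0)<S_1(1)\le S_2(0)<S_2(1)\le\dots<S_N(1)=1$. Let $\mu_1,\dots,\mu_N\in(0,1)$, $\sum_i\mu_i=1$. $\mu$ is the unique Borel probability measure on $[0,1]$ with $\mu(A)=\sum_{i=1}^N\mu_i\,\mu(S_i^{-1}(A))$ for all Borel $A$; $F=\operatorname{supp}\mu$ is the associated self-similar set. The spectral exponent $\gamma$ is the unique solution of $\sum_{i=1}^N(\mu_ir_i)^\gamma=1$, and $\delta=\max_{1\le i\le N}\frac{\log\mu_i}{\log((\mu_ir_i)^\gamma)}$. $\mathcal H=L^2([0,1],\mu)$ with inner product $\langle\cdot,\cdot\rangle_\mu$. $\mathcal D_\mu^2$ is the set of $f\in C^1((0,1))\cap C^0([0,1])$ for which there is $(f')^\mu\in \mathcal L^2([0,1],\mu)$ with $f'(x)=f'(0)+\int_0^x(f')^\mu d\mu$, $x\in[0,1]$; $\Delta_\mu f=(f')^\mu$. $\Delta_\mu^N$ (resp. $\Delta_\mu^D$) is its restriction to the elements of $\mathcal H$ having a representative $f\in\mathcal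 D_\mu^2$ with $f'(0)=f'(1)=0$ (resp. $f(0)=f(1)=0$). $-\Delta_\mu^b$ is non-negative self-adjoint on $\mathcal H$ with an orthonormal basis of eigenfunctions $\varphi_k^b$, $k\ge1$ (taken as their representatives in $\mathcal D_\mu^2$), and increasingly ordered eigenvalues $\lambda_k^b$; $\lambda_1^D>0$, $\lambda_1^N=0$, $\varphi_1^N\equiv1$. The wave propagators are $P_D(t,x,y)=\sum_{k\ge1}\frac{\sin(\sqrt{\lambda_k^D}t)}{\sqrt{\lambda_k^D}}\varphi_k^D(x)\varphi_k^D(y)$ and $P_N(t,x,y)=t+\sum_{k\ge2}\frac{\sin(\sqrt{\lambda_k^N}t)}{\sqrt{\lambda_k^N}}\varphi_k^N(x)\varphi_k^N(y)$. Finite words: $\mathbb W^*=\bigcup_{m\ge1}\{1,\dots,N\}^m$; for $\omega=\omega_1\dots\omega_m$ put $r_\omega=r_{\omega_1}\cdots r_{\omega_m}$, $S_\omega=S_{\omega_1}\circ\dots\circ S_{\omega_m}$, $F_\omega=S_\omega(F)$. With $r_{\max}=\max_ir_i$ and $n\ge1$, $\Lambda_n=\{\omega_1\dots\omega_m\in\mathbb W^*: r_{\omega_1}\cdots r_{\omega_{m-1}}>r_{\max}^n\ge r_\omega\}$ (empty product $=1$). For $x\in F$: $D_n^0(x)=\bigcup\{F_\omega:\omega\in\Lambda_n,\ x\in F_\omega\}$ and $f_n^x=\mu(D_n^0(x))^{-1}\mathbf 1_{D_n^0(x)}$. *)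

theory Defs
  imports "HOL-Probability.Probability"
begin

section \<open>The iterated function system and its self-similar measure\<close>

definition similitude :: "(nat \<Rightarrow> real) \<Rightarrow> (nat \<Rightarrow> real) \<Rightarrow> nat \<Rightarrow> real \<Rightarrow> real" where
  "similitude r b i x = r i * x + b i"

definition interval_ifs :: "nat \<Rightarrow> (nat \<Rightarrow> real) \<Rightarrow> (nat \<Rightarrow> real) \<Rightarrow> bool" where
  "interval_ifs N r b \<longleftrightarrow>
     N \<ge> 2 \<and>
     (\<forall>i\<in>{1..N}. 0 < r i \<and> r i < 1 \<and> 0 \<le> b i \<and> b i \<le> 1 - r i) \<and>
     similitude r b 1 0 = 0 \<and>
     (\<forall>i\<in>{1..N}. similitude r b i 0 < similitude r b i 1) \<and>
     (\<forall>i\<in>{1..<N}. similitude r b i 1 \<le> similitude r b (Suc i) 0) \<and>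
     similitude r b N 1 = 1"

definition prob_weights :: "nat \<Rightarrow> (nat \<Rightarrow> real) \<Rightarrow> bool" where
  "prob_weights N m \<longleftrightarrow> (\<forall>i\<in>{1..N}. 0 < m i \<and> m i < 1) \<and> (\<Sum>i=1..N. m i) = 1"

definition self_similar_measure ::
  "nat \<Rightarrow> (nat \<Rightarrow> real) \<Rightarrow> (nat \<Rightarrow> real) \<Rightarrow> (nat \<Rightarrow> real) \<Rightarrow> real measure \<Rightarrow> bool" where
  "self_similar_measure N r b m \<mu> \<longleftrightarrow>
     prob_space \<mu> \<and> space \<mu> = {0..1} \<and> sets \<mu> = sets (restrict_space borel {0..1}) \<and>
     (\<forall>A\<in>sets \<mu>. measure \<mu> A = (\<Sum>i=1..N. m i * measure \<mu> (similitude r b i -` A \<inter> {0..1})))"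

definition supp :: "real measure \<Rightarrow> real set" where
  "supp \<mu> = {x \<in> space \<mu>. \<forall>U. open U \<longrightarrow> x \<in> U \<longrightarrow> 0 < measure \<mu> (U \<inter> space \<mu>)}"

definition spectral_exponent :: "nat \<Rightarrow> (nat \<Rightarrow> real) \<Rightarrow> (nat \<Rightarrow> real) \<Rightarrow> real" where
  "spectral_exponent N r m = (THE \<gamma>. (\<Sum>i=1..N. (m i * r i) powr \<gamma>) = 1)"

definition delta_exponent :: "nat \<Rightarrow> (nat \<Rightarrow> real) \<Rightarrow> (nat \<Rightarrow> real) \<Rightarrow> real" where
  "delta_exponent N r m =
     Max ((\<lambda>i. ln (m i) / ln ((m i * r i) powr spectral_exponent N r m)) ` {1..N})"

section \<open>Square-integrable functions\<close>

text \<open>Elements of \<open>L\<^sup>2([0,1],\<mu>)\<close> are handled through their representatives.\<close>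

definition L2 :: "real measure \<Rightarrow> (real \<Rightarrow> real) set" where
  "L2 \<mu> = {f \<in> borel_measurable \<mu>. integrable \<mu> (\<lambda>x. (f x)\<^sup>2)}"

definition L2_inner :: "real measure \<Rightarrow> (real \<Rightarrow> real) \<Rightarrow> (real \<Rightarrow> real) \<Rightarrow> real" where
  "L2_inner \<mu> f g = (\<integral>x. f x * g x \<partial>\<mu>)"

definition L2_tendsto :: "real measure \<Rightarrow> (nat \<Rightarrow> real \<Rightarrow> real) \<Rightarrow> (real \<Rightarrow> real) \<Rightarrow> bool" where
  "L2_tendsto \<mu> s f \<longleftrightarrow>
     (\<forall>n. s n \<in> L2 \<mu>) \<and> f \<in> L2 \<mu> \<and> (\<lambda>n. \<integral>x. (s n x - f x)\<^sup>2 \<partial>\<mu>) \<longlonglongrightarrow> 0"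

section \<open>The Krein--Feller operators\<close>

datatype boundary = Neumann | Dirichlet

text \<open>\<open>mu_deriv2 \<mu> f f' g\<close>: \<open>f\<close> lies in \<open>\<D>\<^sub>\<mu>\<^sup>2\<close> with derivative \<open>f'\<close> and \<open>(f')\<^sup>\<mu> = g\<close>. At the
  endpoints \<open>f'\<close> is the one-sided derivative, which is what the integral identity on the closed
  interval refers to. Values of \<open>f\<close> outside \<open>[0,1]\<close> are irrelevant.\<close>

definition mu_deriv2 ::
  "real measure \<Rightarrow> (real \<Rightarrow> real) \<Rightarrow> (real \<Rightarrow> real) \<Rightarrow> (real \<Rightarrow> real) \<Rightarrow> bool" where
  "mu_deriv2 \<mu> f f' g \<longleftrightarrow>
     continuous_on {0..1} f \<and>
     (\<forall>x\<in>{0..1}. (f has_real_derivative f' x) (at x within {0..1})) \<and>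
     continuous_on {0<..<1} f' \<and>
     g \<in> L2 \<mu> \<and>
     (\<forall>x\<in>{0..1}. f' x = f' 0 + (LINT y:{0..x}|\<mu>. g y))"

definition krein_feller ::
  "boundary \<Rightarrow> real measure \<Rightarrow> (real \<Rightarrow> real) \<Rightarrow> (real \<Rightarrow> real) \<Rightarrow> bool" where
  "krein_feller bc \<mu> f g \<longleftrightarrow>
     (\<exists>f'. mu_deriv2 \<mu> f f' g \<and>
        (case bc of Neumann \<Rightarrow> f' 0 = 0 \<and> f' 1 = 0 | Dirichlet \<Rightarrow> f 0 = 0 \<and> f 1 = 0))"

text \<open>The index starts at 1; the values at index 0 are irrelevant. In the Neumann case the sign of
  the first eigenfunction is fixed by \<open>\<phi>\<^sub>1 = 1\<close>; this entails \<open>\<lambda>\<^sub>1 = 0\<close>. Positivity of the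
  first Dirichlet eigenvalue is a consequence and not imposed.\<close>

definition eigenbasis ::
  "boundary \<Rightarrow> real measure \<Rightarrow> (nat \<Rightarrow> real) \<Rightarrow> (nat \<Rightarrow> real \<Rightarrow> real) \<Rightarrow> bool" where
  "eigenbasis bc \<mu> lam \<phi> \<longleftrightarrow>
     (\<forall>k\<ge>1. \<phi> k \<in> L2 \<mu> \<and> krein_feller bc \<mu> (\<phi> k) (\<lambda>x. - (lam k * \<phi> k x))) \<and>
     (\<forall>j\<ge>1. \<forall>k\<ge>1. L2_inner \<mu> (\<phi> j) (\<phi> k) = (if j = k then 1 else 0)) \<and>
     (\<forall>f\<in>L2 \<mu>. L2_tendsto \<mu> (\<lambda>n x. \<Sum>k=1..n. L2_inner \<mu> f (\<phi> k) * \<phi> k x) f) \<and>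
     (\<forall>j\<ge>1. \<forall>k\<ge>j. lam j \<le> lam k) \<and>
     (bc = Neumann \<longrightarrow> (\<forall>x\<in>{0..1}. \<phi> 1 x = 1))"

section \<open>The wave propagators\<close>

definition wave_partial ::
  "boundary \<Rightarrow> (nat \<Rightarrow> real) \<Rightarrow> (nat \<Rightarrow> real \<Rightarrow> real) \<Rightarrow> nat \<Rightarrow> real \<Rightarrow> real \<Rightarrow> real \<Rightarrow> real" where
  "wave_partial bc lam \<phi> n t x y =
     (case bc of
        Dirichlet \<Rightarrow> (\<Sum>k=1..n. sin (sqrt (lam k) * t) / sqrt (lam k) * \<phi> k x * \<phi> k y)
      | Neumann \<Rightarrow> t + (\<Sum>k=2..n. sin (sqrt (lam k) * t) / sqrt (lam k) * \<phi> k x * \<phi> k y))"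

text \<open>The series defining the propagator converges in \<open>L\<^sup>2([0,1],\<mu>)\<close> in either space variable when
  the other one is fixed, but it need not converge absolutely. Accordingly, a propagator is a
  function all of whose sections are representatives of the corresponding \<open>L\<^sup>2\<close>-sums.\<close>

definition wave_propagator ::
  "boundary \<Rightarrow> real measure \<Rightarrow> (nat \<Rightarrow> real) \<Rightarrow> (nat \<Rightarrow> real \<Rightarrow> real)
     \<Rightarrow> (real \<Rightarrow> real \<Rightarrow> real \<Rightarrow> real) \<Rightarrow> bool" where
  "wave_propagator bc \<mu> lam \<phi> P \<longleftrightarrow>
     (\<forall>t\<ge>0. \<forall>x\<in>{0..1}. L2_tendsto \<mu> (\<lambda>n y. wave_partial bc lam \<phi> n t x y) (\<lambda>y. P t x y)) \<and>
     (\<forall>t\<ge>0. \<forall>y\<in>{0..1}. L2_tendsto \<mu> (\<lambda>n x. wave_partial bc lam \<phi> n t x y) (\<lambda>x. P t x y))"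

section \<open>Words and the approximating functions\<close>

definition word_ratio :: "(nat \<Rightarrow> real) \<Rightarrow> nat list \<Rightarrow> real" where
  "word_ratio r w = prod_list (map r w)"

definition word_map :: "(nat \<Rightarrow> real) \<Rightarrow> (nat \<Rightarrow> real) \<Rightarrow> nat list \<Rightarrow> real \<Rightarrow> real" where
  "word_map r b w = foldr (similitude r b) w"

definition r_max :: "nat \<Rightarrow> (nat \<Rightarrow> real) \<Rightarrow> real" where
  "r_max N r = Max (r ` {1..N})"

definition word_partition :: "nat \<Rightarrow> (nat \<Rightarrow> real) \<Rightarrow> nat \<Rightarrow> nat list set" where
  "word_partition N r n =
     {w. w \<noteq> [] \<and> set w \<subseteq> {1..N} \<and>
         word_ratio r (butlast w) > r_max N r ^ n \<and> r_max N r ^ n \<ge> word_ratio r w}"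

definition cell_nbhd ::
  "nat \<Rightarrow> (nat \<Rightarrow> real) \<Rightarrow> (nat \<Rightarrow> real) \<Rightarrow> real measure \<Rightarrow> nat \<Rightarrow> real \<Rightarrow> real set" where
  "cell_nbhd N r b \<mu> n x =
     \<Union>{word_map r b w ` supp \<mu> | w. w \<in> word_partition N r n \<and> x \<in> word_map r b w ` supp \<mu>}"

definition approx_delta ::
  "nat \<Rightarrow> (nat \<Rightarrow> real) \<Rightarrow> (nat \<Rightarrow> real) \<Rightarrow> real measure \<Rightarrow> nat \<Rightarrow> real \<Rightarrow> real \<Rightarrow> real" where
  "approx_delta N r b \<mu> n x y =
     inverse (measure \<mu> (cell_nbhd N r b \<mu> n x)) * indicator (cell_nbhd N r b \<mu> n x) y"

end

theory Submission
  imports Defs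
begin

text \<open>
  The series of the propagator is controlled by an \<^emph>\<open>energy\<close> argument. Integration by parts turns
  \<open>- \<Delta>\<^sub>\<mu> \<phi>\<^sub>k = \<lambda>\<^sub>k \<phi>\<^sub>k\<close> into the statement that the derivatives \<open>\<phi>\<^sub>k'\<close> are orthogonal in
  \<open>L\<^sup>2([0,1], dx)\<close> with \<open>\<parallel>\<phi>\<^sub>k'\<parallel>\<^sup>2 = \<lambda>\<^sub>k\<close> (\<open>energy_integration_by_parts\<close>). Since
  \<open>\<phi>\<^sub>k(z) - \<phi>\<^sub>k(x)\<close> is the inner product of \<open>\<phi>\<^sub>k'\<close> with the indicator of \<open>[x,z]\<close>, Bessel's inequality
  yields \<open>\<Sum> (\<phi>\<^sub>k(z) - \<phi>\<^sub>k(x))\<^sup>2 / \<lambda>\<^sub>k \<le> |z - x|\<close>, the sum running over \<open>\<lambda>\<^sub>k > 0\<close>. The squared wave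
  coefficients \<open>sin\<^sup>2(t \<surd>\<lambda>\<^sub>k) / \<lambda>\<^sub>k\<close> are at most \<open>1 / \<lambda>\<^sub>k\<close>, so \<open>P(t,z,\<cdot>)\<close> and \<open>P(t,x,\<cdot>)\<close> differ in
  \<open>L\<^sup>2(\<mu>)\<close> by at most the square root of \<open>|z - x|\<close> (\<open>coeff_increment_bound\<close>).

  Integrating \<open>P(t,\<cdot>,y)\<close> against the normalised indicator of a set \<open>D\<close> averages \<open>P(t,z,y)\<close> over
  \<open>z \<in> D\<close>, so by convexity the squared averaging error is at most the largest \<open>|z - x|\<close>, \<open>z \<in> D\<close>
  (\<open>propagator_average_error\<close>). For the neighbourhood \<open>D\<^sub>n\<^sup>0(x)\<close> this is at most the \<open>n\<close>-th power of the
  largest ratio (\<open>cell_nbhd_near\<close>), which tends to \<open>0\<close>; the averages make sense because \<open>x\<close> lies in some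
  cell and every cell has positive measure (\<open>cell_nbhd_measure_pos\<close>).

  A propagator is one function with all its sections prescribed. It exists because the tails of the
  coefficient series are small uniformly in \<open>x\<close> (\<open>coeff_tail_uniform\<close>): the partial sums along one
  subsequence, the same for all \<open>x\<close>, then converge for almost every \<open>y\<close>, and their limit is
  symmetric (\<open>wave_kernel_exists\<close>).
\<close>

section \<open>Square-integrable functions\<close>

lemma L2_measurable: "f \<in> L2 M \<Longrightarrow> f \<in> borel_measurable M"
  by (simp add: L2_def)

lemma L2_square_integrable: "f \<in> L2 M \<Longrightarrow> integrable M (\<lambda>x. (f x)\<^sup>2)"
  by (simp add: L2_def)

lemma L2_mult_integrable:
  assumes "f \<in> L2 M" "g \<in> L2 M"
  shows "integrable M (\<lambda>x. f x * g x)"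
proof (rule Bochner_Integration.integrable_bound)
  show "integrable M (\<lambda>x. (f x)\<^sup>2 + (g x)\<^sup>2)"
    using assms by (auto simp: L2_def)
  show "(\<lambda>x. f x * g x) \<in> borel_measurable M"
    using assms by (auto simp: L2_def)
  have "\<bar>u * v\<bar> \<le> u\<^sup>2 + v\<^sup>2" for u v :: real
    using sum_squares_bound[of "\<bar>u\<bar>" "\<bar>v\<bar>"] mult_nonneg_nonneg[of "\<bar>u\<bar>" "\<bar>v\<bar>"]
    unfolding abs_mult power2_abs by linarith
  then show "AE x in M. norm (f x * g x) \<le> norm ((f x)\<^sup>2 + (g x)\<^sup>2)"
    by (intro AE_I2) simp
qed

lemma L2_add:
  assumes "f \<in> L2 M" "g \<in> L2 M"
  shows "(\<lambda>x. f x + g x) \<in> L2 M"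
proof -
  have "integrable M (\<lambda>x. (f x)\<^sup>2 + (g x)\<^sup>2 + 2 * (f x * g x))"
    using assms L2_mult_integrable[OF assms] by (auto simp: L2_def)
  then show ?thesis
    using assms by (auto simp: L2_def power2_sum mult.assoc)
qed

lemma L2_cmult: "f \<in> L2 M \<Longrightarrow> (\<lambda>x. c * f x) \<in> L2 M"
  by (auto simp: L2_def power_mult_distrib)

lemma L2_diff:
  assumes "f \<in> L2 M" "g \<in> L2 M"
  shows "(\<lambda>x. f x - g x) \<in> L2 M"
  using L2_add[OF assms(1) L2_cmult[OF assms(2), of "-1"]] by simp

lemma L2_sum:
  assumes "\<And>k. k \<in> K \<Longrightarrow> e k \<in> L2 M"
  shows "(\<lambda>x. \<Sum>k\<in>K. d k * e k x) \<in> L2 M"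
proof (cases "finite K")
  case True
  then show ?thesis using assms
    by (induction K rule: finite_induct) (auto intro!: L2_add L2_cmult, simp add: L2_def)
qed (simp add: L2_def)

lemma L2_cong:
  assumes "\<And>x. x \<in> space M \<Longrightarrow> f x = g x"
  shows "f \<in> L2 M \<longleftrightarrow> g \<in> L2 M"
proof -
  have "integrable M (\<lambda>x. (f x)\<^sup>2) \<longleftrightarrow> integrable M (\<lambda>x. (g x)\<^sup>2)"
    by (rule Bochner_Integration.integrable_cong) (use assms in auto)
  moreover have "f \<in> borel_measurable M \<longleftrightarrow> g \<in> borel_measurable M"
    by (rule measurable_cong) (use assms in auto)
  ultimately show ?thesis by (simp add: L2_def)
qed

lemma L2_const: "finite_measure M \<Longrightarrow> (\<lambda>x. c) \<in> L2 M"
  by (simp add: L2_def finite_measure.integrable_const)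

lemma L2_indicator: "finite_measure M \<Longrightarrow> A \<in> sets M \<Longrightarrow> indicator A \<in> L2 M"
  unfolding L2_def
  by (auto intro!: finite_measure.integrable_const_bound[where B=1] simp: indicator_def)

lemma L2_Cauchy_Schwarz:
  assumes f: "f \<in> L2 M" and g: "g \<in> L2 M"
  shows "(\<integral>x. f x * g x \<partial>M)\<^sup>2 \<le> (\<integral>x. (f x)\<^sup>2 \<partial>M) * (\<integral>x. (g x)\<^sup>2 \<partial>M)"
proof -
  define A B G where "A = (\<integral>x. (f x)\<^sup>2 \<partial>M)" and "B = (\<integral>x. f x * g x \<partial>M)"
    and "G = (\<integral>x. (g x)\<^sup>2 \<partial>M)"
  have nonneg: "0 \<le> A - 2 * s * B + s\<^sup>2 * G" for s
  proof -
    have "0 \<le> (\<integral>x. (f x - s * g x)\<^sup>2 \<partial>M)" by simp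
    also have "\<dots> = (\<integral>x. (f x)\<^sup>2 - 2 * s * (f x * g x) + s\<^sup>2 * (g x)\<^sup>2 \<partial>M)"
      by (rule Bochner_Integration.integral_cong) (auto simp: power2_eq_square algebra_simps)
    also have "\<dots> = A - 2 * s * B + s\<^sup>2 * G"
      using L2_mult_integrable[OF f g] f g
      by (simp add: A_def B_def G_def L2_def)
    finally show ?thesis .
  qed
  have "B\<^sup>2 \<le> A * G"
  proof (cases "G = 0")
    case True
    have "B = 0"
    proof (rule ccontr)
      assume "B \<noteq> 0"
      \<comment> \<open>with \<open>G = 0\<close> the quadratic is affine in \<open>s\<close>; at this point it equals \<open>-1\<close>\<close>
      then show False using nonneg[of "(A + 1) / (2 * B)"] True by simp
    qed
    then show ?thesis using True by simp
  next
    case False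
    moreover have "0 \<le> G" by (simp add: G_def)
    ultimately have "G > 0" by simp
    then show ?thesis using nonneg[of "B / G"]
      by (simp add: field_simps power2_eq_square)
  qed
  then show ?thesis by (simp add: A_def B_def G_def)
qed

lemma orthogonal_sum_square_integral:
  assumes "finite K" and e: "\<And>k. k \<in> K \<Longrightarrow> e k \<in> L2 M"
    and orth: "\<And>j k. j \<in> K \<Longrightarrow> k \<in> K \<Longrightarrow> (\<integral>x. e j x * e k x \<partial>M) = (if j = k then l k else 0)"
  shows "(\<integral>x. (\<Sum>k\<in>K. d k * e k x)\<^sup>2 \<partial>M) = (\<Sum>k\<in>K. (d k)\<^sup>2 * l k)"
proof -
  have "(\<integral>x. (\<Sum>k\<in>K. d k * e k x)\<^sup>2 \<partial>M)
      = (\<integral>x. (\<Sum>j\<in>K. \<Sum>k\<in>K. d j * d k * (e j x * e k x)) \<partial>M)"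
    by (rule Bochner_Integration.integral_cong)
       (auto simp: power2_eq_square sum_product mult_ac)
  also have "\<dots> = (\<Sum>j\<in>K. \<Sum>k\<in>K. d j * d k * (\<integral>x. e j x * e k x \<partial>M))"
    using L2_mult_integrable[OF e e]
    by (subst Bochner_Integration.integral_sum, force)+ (auto intro!: sum.cong)
  also have "\<dots> = (\<Sum>j\<in>K. \<Sum>k\<in>K. if j = k then d j * d k * l k else 0)"
    by (intro sum.cong) (auto simp: orth)
  also have "\<dots> = (\<Sum>k\<in>K. (d k)\<^sup>2 * l k)"
    using \<open>finite K\<close> by (simp add: power2_eq_square)
  finally show ?thesis .
qed

lemma Bessel_inequality:
  assumes "finite K" and e: "\<And>k. k \<in> K \<Longrightarrow> e k \<in> L2 M" and f: "f \<in> L2 M"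
    and orth: "\<And>j k. j \<in> K \<Longrightarrow> k \<in> K \<Longrightarrow> (\<integral>x. e j x * e k x \<partial>M) = (if j = k then l k else 0)"
    and l: "\<And>k. k \<in> K \<Longrightarrow> l k > 0"
  shows "(\<Sum>k\<in>K. (\<integral>x. f x * e k x \<partial>M)\<^sup>2 / l k) \<le> (\<integral>x. (f x)\<^sup>2 \<partial>M)"
proof -
  define c where "c k = (\<integral>x. f x * e k x \<partial>M)" for k
  define g where "g x = (\<Sum>k\<in>K. (c k / l k) * e k x)" for x
  have g: "g \<in> L2 M" unfolding g_def by (intro L2_sum e)
  have gg: "(\<integral>x. (g x)\<^sup>2 \<partial>M) = (\<Sum>k\<in>K. (c k)\<^sup>2 / l k)"
    unfolding g_def
    by (subst orthogonal_sum_square_integral[OF assms(1) e orth])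
       (use l in \<open>auto intro!: sum.cong simp: power2_eq_square\<close>)
  have "(\<integral>x. f x * g x \<partial>M) = (\<integral>x. (\<Sum>k\<in>K. (c k / l k) * (f x * e k x)) \<partial>M)"
    by (rule Bochner_Integration.integral_cong) (auto simp: g_def sum_distrib_left mult_ac)
  also have "\<dots> = (\<Sum>k\<in>K. (c k)\<^sup>2 / l k)"
    using L2_mult_integrable[OF f e]
    by (subst Bochner_Integration.integral_sum) (auto simp: c_def power2_eq_square intro!: sum.cong)
  finally have fg: "(\<integral>x. f x * g x \<partial>M) = (\<Sum>k\<in>K. (c k)\<^sup>2 / l k)" .
  have "0 \<le> (\<integral>x. (f x - g x)\<^sup>2 \<partial>M)" by simp
  also have "\<dots> = (\<integral>x. (f x)\<^sup>2 - 2 * (f x * g x) + (g x)\<^sup>2 \<partial>M)"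
    by (rule Bochner_Integration.integral_cong) (auto simp: power2_eq_square algebra_simps)
  also have "\<dots> = (\<integral>x. (f x)\<^sup>2 \<partial>M) - (\<Sum>k\<in>K. (c k)\<^sup>2 / l k)"
    using L2_mult_integrable[OF f g] f g by (simp add: L2_def fg gg)
  finally show ?thesis by (simp add: c_def)
qed

lemma L2_tendsto_inner:
  assumes "L2_tendsto M s f" "g \<in> L2 M"
  shows "(\<lambda>n. L2_inner M (s n) g) \<longlonglongrightarrow> L2_inner M f g"
proof -
  have s: "s n \<in> L2 M" and f: "f \<in> L2 M" for n
    using assms by (auto simp: L2_tendsto_def)
  define G where "G = (\<integral>x. (g x)\<^sup>2 \<partial>M)"
  have lim: "(\<lambda>n. sqrt ((\<integral>x. (s n x - f x)\<^sup>2 \<partial>M) * G)) \<longlonglongrightarrow> 0"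
    using assms tendsto_real_sqrt[OF tendsto_mult_left_zero[where c=G]]
    by (fastforce simp: L2_tendsto_def)
  have "norm (L2_inner M (s n) g - L2_inner M f g)
      \<le> sqrt ((\<integral>x. (s n x - f x)\<^sup>2 \<partial>M) * G)" for n
  proof -
    have "L2_inner M (s n) g - L2_inner M f g = (\<integral>x. (s n x - f x) * g x \<partial>M)"
      using L2_mult_integrable[OF s assms(2), of n] L2_mult_integrable[OF f assms(2)]
      by (simp add: L2_inner_def left_diff_distrib)
    then show ?thesis
      using L2_Cauchy_Schwarz[OF L2_diff[OF s f] assms(2), of n]
      by (simp add: real_le_rsqrt G_def)
  qed
  then show ?thesis
    by (intro LIM_zero_cancel[OF Lim_null_comparison[OF _ lim]]) simp
qed

lemma L2_tendsto_AE_subseq: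
  assumes "finite_measure M" "L2_tendsto M s f"
  obtains r where "strict_mono r" "AE x in M. (\<lambda>n. s (r n) x) \<longlonglongrightarrow> f x"
proof -
  interpret finite_measure M by fact
  have "L2_tendsto M s f" by fact
  then have "integrable M (\<lambda>x. (s n x - f x)\<^sup>2)" for n
    by (auto simp: L2_tendsto_def intro!: L2_square_integrable L2_diff)
  moreover have "(\<lambda>n. \<integral>x. norm ((s n x - f x)\<^sup>2) \<partial>M) \<longlonglongrightarrow> 0"
    using assms by (simp add: L2_tendsto_def)
  ultimately obtain r where "strict_mono r" "AE x in M. (\<lambda>n. (s (r n) x - f x)\<^sup>2) \<longlonglongrightarrow> 0"
    using tendsto_L1_AE_subseq[of M "\<lambda>n x. (s n x - f x)\<^sup>2"] by blast
  moreover have "(\<lambda>n. s (r n) x) \<longlonglongrightarrow> f x" if "(\<lambda>n. (s (r n) x - f x)\<^sup>2) \<longlonglongrightarrow> 0" for x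
    using tendsto_real_sqrt[OF that] by (simp add: tendsto_rabs_zero_iff LIM_zero_iff)
  ultimately show ?thesis using that by (metis (mono_tags, lifting) AE_mp AE_I2)
qed

text \<open>Fatou's lemma for squares: it carries every \<open>L\<^sup>2\<close>-estimate on infinite sums below over from the
  partial sums.\<close>

lemma L2_Fatou:
  assumes s: "\<And>n. s n \<in> L2 M" and f: "f \<in> borel_measurable M"
    and lim: "AE x in M. (\<lambda>n. s n x) \<longlonglongrightarrow> f x"
    and bound: "\<forall>\<^sub>F n in sequentially. (\<integral>x. (s n x)\<^sup>2 \<partial>M) \<le> B"
  shows "f \<in> L2 M" "(\<integral>x. (f x)\<^sup>2 \<partial>M) \<le> B"
proof -
  obtain n where "(\<integral>x. (s n x)\<^sup>2 \<partial>M) \<le> B"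
    using bound eventually_happens'[OF sequentially_bot] by blast
  moreover have "0 \<le> (\<integral>x. (s n x)\<^sup>2 \<partial>M)" by simp
  ultimately have "B \<ge> 0" by linarith
  have "(\<integral>\<^sup>+x. ennreal ((f x)\<^sup>2) \<partial>M) = (\<integral>\<^sup>+x. liminf (\<lambda>n. ennreal ((s n x)\<^sup>2)) \<partial>M)"
  proof (rule nn_integral_cong_AE)
    show "AE x in M. ennreal ((f x)\<^sup>2) = liminf (\<lambda>n. ennreal ((s n x)\<^sup>2))"
      using lim
    proof eventually_elim
      case (elim x)
      then have "(\<lambda>n. ennreal ((s n x)\<^sup>2)) \<longlonglongrightarrow> ennreal ((f x)\<^sup>2)"
        by (intro tendsto_ennrealI tendsto_power)
      then show ?case using lim_imp_Liminf[OF sequentially_bot] by metis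
    qed
  qed
  also have "\<dots> \<le> liminf (\<lambda>n. \<integral>\<^sup>+x. ennreal ((s n x)\<^sup>2) \<partial>M)"
    by (rule nn_integral_liminf) (use s in \<open>auto simp: L2_def\<close>)
  also have "\<dots> = liminf (\<lambda>n. ennreal (\<integral>x. (s n x)\<^sup>2 \<partial>M))"
    using s by (simp add: nn_integral_eq_integral L2_def)
  also have "\<dots> \<le> liminf (\<lambda>n. ennreal B)"
    by (rule Liminf_mono) (use bound in \<open>auto elim: eventually_mono intro: ennreal_leI\<close>)
  also have "\<dots> = ennreal B" by (simp add: Liminf_const)
  finally have le: "(\<integral>\<^sup>+x. ennreal ((f x)\<^sup>2) \<partial>M) \<le> ennreal B" .
  then have int: "integrable M (\<lambda>x. (f x)\<^sup>2)"
    using f by (intro integrableI_bounded) (auto intro: le_less_trans)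
  then show "f \<in> L2 M" using f by (simp add: L2_def)
  from le have "ennreal (\<integral>x. (f x)\<^sup>2 \<partial>M) \<le> ennreal B"
    using nn_integral_eq_integral[OF int] by simp
  then show "(\<integral>x. (f x)\<^sup>2 \<partial>M) \<le> B" using \<open>B \<ge> 0\<close> by simp
qed

lemma indicator_square: "(indicator A x :: real)\<^sup>2 = indicator A x"
  by (simp add: indicator_def)

text \<open>The rate makes the \<open>L\<^sup>1\<close>-norms of the increments summable, so the increments themselves are
  absolutely summable almost everywhere. The sequence is not thinned out any further, which is what
  allows one subsequence to serve a whole family of functions.\<close>

lemma AE_convergent_fast_L2:
  assumes "prob_space M" and s: "\<And>j. s j \<in> L2 M"
    and fast: "\<And>j. (\<integral>x. (s (Suc j) x - s j x)\<^sup>2 \<partial>M) \<le> (1/4) ^ j"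
  shows "AE x in M. convergent (\<lambda>j. s j x)"
proof -
  interpret prob_space M by fact
  define g where "g j x = s (Suc j) x - s j x" for j x
  have g: "g j \<in> L2 M" for j
    unfolding g_def[abs_def] by (intro L2_diff s)
  have [measurable]: "g j \<in> borel_measurable M" for j by (rule L2_measurable[OF g])
  have gi: "integrable M (g j)" for j
    by (rule square_integrable_imp_integrable[OF L2_measurable[OF g] L2_square_integrable[OF g]])
  have bound: "(\<integral>x. \<bar>g j x\<bar> \<partial>M) \<le> (1/2) ^ j" for j
  proof -
    have "(\<lambda>x. \<bar>g j x\<bar>) \<in> L2 M" using L2_square_integrable[OF g] by (simp add: L2_def)
    moreover have "(\<lambda>x. 1) \<in> L2 M" by (simp add: L2_def)
    ultimately have "(\<integral>x. \<bar>g j x\<bar> \<partial>M)\<^sup>2 \<le> (\<integral>x. (g j x)\<^sup>2 \<partial>M)"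
      using L2_Cauchy_Schwarz[of "\<lambda>x. \<bar>g j x\<bar>" M "\<lambda>x. 1"] by (simp add: prob_space)
    also have "\<dots> \<le> (1/4) ^ j" using fast by (simp add: g_def)
    also have "\<dots> = ((1/2) ^ j)\<^sup>2" by (simp add: power2_eq_square flip: power_mult_distrib)
    finally show ?thesis by (rule power2_le_imp_le) simp
  qed
  have "(\<integral>\<^sup>+x. (\<Sum>j. ennreal \<bar>g j x\<bar>) \<partial>M) = (\<Sum>j. \<integral>\<^sup>+x. ennreal \<bar>g j x\<bar> \<partial>M)"
    by (rule nn_integral_suminf) measurable
  also have "\<dots> = (\<Sum>j. ennreal (\<integral>x. \<bar>g j x\<bar> \<partial>M))"
    using gi by (simp add: nn_integral_eq_integral)
  also have "\<dots> \<le> (\<Sum>j. ennreal ((1/2) ^ j))"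
    by (intro suminf_le ennreal_leI bound) auto
  also have "\<dots> = ennreal (\<Sum>j. (1/2) ^ j)"
    by (rule suminf_ennreal2) (auto intro: summable_geometric)
  finally have "(\<integral>\<^sup>+x. (\<Sum>j. ennreal \<bar>g j x\<bar>) \<partial>M) \<noteq> \<infinity>"
    by (auto simp: top_unique)
  then have "AE x in M. (\<Sum>j. ennreal \<bar>g j x\<bar>) \<noteq> \<infinity>"
    by (intro nn_integral_PInf_AE) measurable
  then show ?thesis
  proof eventually_elim
    case (elim x)
    then have "summable (\<lambda>j. \<bar>g j x\<bar>)"
      by (intro summable_suminf_not_top) auto
    then have "summable (\<lambda>j. g j x)" by (rule summable_rabs_cancel)
    then have "convergent (\<lambda>j. \<Sum>i<j. g i x)" by (simp add: summable_iff_convergent)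
    then have "convergent (\<lambda>j. s j x - s 0 x)"
      by (simp add: g_def sum_lessThan_telescope[of "\<lambda>j. s j x"])
    then show ?case using convergent_diff_const_right_iff by blast
  qed
qed

lemma bounded_supp_L2:
  assumes "u \<in> borel_measurable borel" "\<And>x. \<bar>u x\<bar> \<le> C" "\<And>x. x \<notin> {0..1} \<Longrightarrow> u x = 0"
  shows "integrable lborel u" "u \<in> L2 lborel"
proof -
  have bd: "integrable lborel v"
    if v: "v \<in> borel_measurable borel" "\<And>x. \<bar>v x\<bar> \<le> D" "\<And>x. x \<notin> {0..1} \<Longrightarrow> v x = 0"
    for v :: "real \<Rightarrow> real" and D
  proof (rule Bochner_Integration.integrable_bound)
    show "integrable lborel (\<lambda>x. D * indicator {0..1::real} x)"
      by (intro integrable_mult_right integrable_real_indicator) auto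
    show "v \<in> borel_measurable lborel" using v(1) by simp
    have "\<bar>v x\<bar> \<le> \<bar>D * indicator {0..1} x\<bar>" for x
      using v(2)[of x] v(3)[of x] by (auto simp: indicator_def)
    then show "AE x in lborel. norm (v x) \<le> norm (D * indicator {0..1} x)"
      by (intro AE_I2) (simp only: real_norm_def)
  qed
  show "integrable lborel u" by (rule bd) (use assms in auto)
  have "integrable lborel (\<lambda>x. (u x)\<^sup>2)"
    by (rule bd[of _ "C\<^sup>2"]) (use assms in \<open>auto simp: abs_le_square_iff[symmetric] intro: order_trans[OF _ abs_ge_self]\<close>)
  then show "u \<in> L2 lborel" using assms by (simp add: L2_def)
qed

section \<open>The energy form\<close>

text \<open>The derivative of an element of the domain is continuous only on the open interval, and its values
  outside \<open>[0,1]\<close> are arbitrary; cutting it off makes it a Borel function on the line without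
  changing any integral over a part of \<open>[0,1]\<close>.\<close>

definition inner_deriv :: "(real \<Rightarrow> real) \<Rightarrow> real \<Rightarrow> real" where
  "inner_deriv f' x = indicator {0<..<1} x * f' x"

lemma mu_deriv2D:
  assumes "mu_deriv2 \<mu> f f' g"
  shows "continuous_on {0..1} f"
    and "\<And>x. x \<in> {0..1} \<Longrightarrow> (f has_real_derivative f' x) (at x within {0..1})"
    and "continuous_on {0<..<1} f'"
    and "g \<in> L2 \<mu>"
    and "\<And>x. x \<in> {0..1} \<Longrightarrow> f' x = f' 0 + (LINT y:{0..x}|\<mu>. g y)"
  using assms unfolding mu_deriv2_def by blast+

locale interval_measure = prob_space \<mu> for \<mu> :: "real measure" +
  assumes space_mu: "space \<mu> = {0..1}"
    and sets_mu: "sets \<mu> = sets (restrict_space borel {0..1})"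
begin

lemma measurable_from_borel:
  assumes "f \<in> borel_measurable borel"
  shows "f \<in> borel_measurable \<mu>"
  using measurable_restrict_space1[OF assms, of "{0..1}"] measurable_cong_sets[OF sets_mu refl]
  by blast

lemma borel_in_sets_mu:
  assumes "A \<in> sets borel" "A \<subseteq> {0..1}"
  shows "A \<in> sets \<mu>"
  using assms unfolding sets_mu by (subst sets_restrict_space_iff) auto

lemma L2_imp_integrable:
  assumes "f \<in> L2 \<mu>"
  shows "integrable \<mu> f"
  by (rule square_integrable_imp_integrable)
     (use assms in \<open>auto simp: L2_def\<close>)

lemma set_integrable_mu:
  fixes g :: "real \<Rightarrow> real"
  assumes "integrable \<mu> g"
  shows "integrable \<mu> (\<lambda>y. indicator {0..x} y * g y)"
proof -
  have "{0..x} \<inter> space \<mu> \<in> sets \<mu>"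
    unfolding space_mu by (rule borel_in_sets_mu) auto
  from Bochner_Integration.integrable_mult_indicator[OF this assms]
  have "integrable \<mu> (\<lambda>y. indicator ({0..x} \<inter> space \<mu>) y *\<^sub>R g y)" .
  then show ?thesis
    by (rule Bochner_Integration.integrable_cong[THEN iffD1, rotated 2]) (auto simp: indicator_def)
qed

lemma inner_deriv_bounded:
  assumes d: "mu_deriv2 \<mu> f f' g"
  obtains C where "C \<ge> 0" "\<And>x. \<bar>inner_deriv f' x\<bar> \<le> C"
proof -
  have g: "integrable \<mu> g"
    using mu_deriv2D(4)[OF d] by (rule L2_imp_integrable)
  define C where "C = \<bar>f' 0\<bar> + (\<integral>y. \<bar>g y\<bar> \<partial>\<mu>)"
  have "\<bar>inner_deriv f' x\<bar> \<le> C" for x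
  proof (cases "x \<in> {0<..<1}")
    case True
    then have "f' x = f' 0 + (LINT y:{0..x}|\<mu>. g y)"
      using mu_deriv2D(5)[OF d, of x] by simp
    moreover have "\<bar>LINT y:{0..x}|\<mu>. g y\<bar> \<le> (\<integral>y. \<bar>g y\<bar> \<partial>\<mu>)"
      unfolding set_lebesgue_integral_def
      by (rule order_trans[OF integral_abs_bound], rule Bochner_Integration.integral_mono)
         (use g set_integrable_mu[OF g] in \<open>auto simp: indicator_def\<close>)
    ultimately show ?thesis using True by (simp add: inner_deriv_def C_def)
  qed (simp add: inner_deriv_def C_def)
  moreover have "C \<ge> 0" by (simp add: C_def)
  ultimately show ?thesis using that by blast
qed

lemma inner_deriv_measurable:
  assumes "mu_deriv2 \<mu> f f' g"
  shows "inner_deriv f' \<in> borel_measurable borel"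
proof -
  have "(\<lambda>x. indicator {0<..<1} x *\<^sub>R f' x) \<in> borel_measurable borel"
    by (rule borel_measurable_continuous_on_indicator) (use mu_deriv2D(3)[OF assms] in auto)
  then show ?thesis by (simp add: inner_deriv_def[abs_def])
qed

lemma inner_deriv_L2:
  assumes "mu_deriv2 \<mu> f f' g"
  shows "inner_deriv f' \<in> L2 lborel" "integrable lborel (inner_deriv f')"
proof -
  obtain C where "\<And>x. \<bar>inner_deriv f' x\<bar> \<le> C" using inner_deriv_bounded[OF assms] by metis
  moreover have "inner_deriv f' x = 0" if "x \<notin> {0..1}" for x
    using that by (auto simp: inner_deriv_def)
  ultimately show "inner_deriv f' \<in> L2 lborel" "integrable lborel (inner_deriv f')"
    using bounded_supp_L2[OF inner_deriv_measurable[OF assms]] by blast+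
qed

lemma integral_inner_deriv:
  assumes d: "mu_deriv2 \<mu> f f' g" and ab: "0 \<le> a" "a \<le> b" "b \<le> 1"
  shows "integrable lborel (\<lambda>x. indicator {a..b} x * inner_deriv f' x)"
    and "(\<integral>x. indicator {a..b} x * inner_deriv f' x \<partial>lborel) = f b - f a"
proof -
  have "(f' has_integral f b - f a) {a..b}"
  proof (rule fundamental_theorem_of_calculus[OF ab(2)])
    fix x assume "x \<in> {a..b}"
    then have "(f has_real_derivative f' x) (at x within {0..1})"
      using mu_deriv2D(2)[OF d, of x] ab by simp
    then have "(f has_real_derivative f' x) (at x within {a..b})"
      by (rule DERIV_subset) (use ab in auto)
    then show "(f has_vector_derivative f' x) (at x within {a..b})"
      by (simp add: has_real_derivative_iff_has_vector_derivative)
  qed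
  then have "(inner_deriv f' has_integral f b - f a) {a..b}"
    by (rule has_integral_spike_finite[of "{0, 1}", rotated 2])
       (use ab in \<open>auto simp: inner_deriv_def indicator_def\<close>)
  moreover have "integrable lborel (\<lambda>x. indicator {a..b} x *\<^sub>R inner_deriv f' x)"
    by (rule Bochner_Integration.integrable_mult_indicator) (use inner_deriv_L2[OF d] in auto)
  ultimately show "integrable lborel (\<lambda>x. indicator {a..b} x * inner_deriv f' x)"
    "(\<integral>x. indicator {a..b} x * inner_deriv f' x \<partial>lborel) = f b - f a"
    using set_borel_integral_eq_integral(2)[of "{a..b}" "inner_deriv f'"]
    by (auto simp: set_integrable_def set_lebesgue_integral_def integral_unique)
qed

text \<open>Write \<open>h'(x) = h'(0) + \<integral> 1{y \<le> x} k(y) d\<mu>(y)\<close> and exchange the integrals; the inner one becomes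
  \<open>\<integral> 1{y \<le> x} f'(x) dx = f(1) - f(y)\<close>. The exchange is legitimate since \<open>f'\<close> is bounded and \<open>k\<close> is
  \<open>\<mu>\<close>-integrable.\<close>

lemma energy_integration_by_parts:
  assumes df: "mu_deriv2 \<mu> f f' g" and dh: "mu_deriv2 \<mu> h h' k"
  shows "(\<integral>x. inner_deriv f' x * inner_deriv h' x \<partial>lborel)
    = h' 1 * f 1 - h' 0 * f 0 - (\<integral>y. k y * f y \<partial>\<mu>)"
proof -
  interpret P: pair_sigma_finite \<mu> lborel
    by (rule pair_sigma_finite.intro[OF sigma_finite_measure_axioms lborel.sigma_finite_measure_axioms])
  let ?u = "inner_deriv f'"
  have k2: "k \<in> L2 \<mu>" by (rule mu_deriv2D(4)[OF dh])
  then have k: "integrable \<mu> k" by (rule L2_imp_integrable)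
  have f2: "f \<in> L2 \<mu>"
  proof -
    have cf: "continuous_on {0..1} f" by (rule mu_deriv2D(1)[OF df])
    have "f \<in> borel_measurable (restrict_space borel {0..1})"
      by (rule borel_measurable_continuous_on_restrict[OF cf])
    then have m: "f \<in> borel_measurable \<mu>"
      using measurable_cong_sets[OF sets_mu refl] by blast
    obtain B where "\<And>x. x \<in> {0..1} \<Longrightarrow> norm (f x) \<le> B"
      using compact_continuous_image[OF cf] compact_imp_bounded
      by (metis (no_types, lifting) bounded_iff compact_Icc imageI)
    then have "AE x in \<mu>. norm ((f x)\<^sup>2) \<le> B\<^sup>2"
      by (intro AE_I2) (auto simp: space_mu abs_le_square_iff[symmetric] intro: order_trans[OF _ abs_ge_self])
    then show ?thesis
      unfolding L2_def using m by (auto intro!: integrable_const_bound)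
  qed
  obtain C where C: "C \<ge> 0" "\<And>x. \<bar>?u x\<bar> \<le> C" using inner_deriv_bounded[OF df] by blast
  have [measurable]: "?u \<in> borel_measurable borel" by (rule inner_deriv_measurable[OF df])
  have [measurable]: "k \<in> borel_measurable \<mu>" using k by simp
  have [measurable]: "(\<lambda>y. y) \<in> borel_measurable \<mu>" by (rule measurable_from_borel) simp
  define F where "F y x = indicator {y..1} x * ?u x * k y" for x y
  have Fm: "case_prod F \<in> borel_measurable (\<mu> \<Otimes>\<^sub>M lborel)"
  proof -
    have "(\<lambda>p. (if fst p \<le> snd p \<and> snd p \<le> 1 then 1 else 0) * ?u (snd p) * k (fst p))
        \<in> borel_measurable (\<mu> \<Otimes>\<^sub>M lborel)"
      by measurable
    moreover have "case_prod F = (\<lambda>p. (if fst p \<le> snd p \<and> snd p \<le> 1 then 1 else 0) * ?u (snd p) * k (fst p))"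
      by (auto simp: F_def fun_eq_iff indicator_def)
    ultimately show ?thesis by simp
  qed
  have Fx: "integrable lborel (F y)" "(\<integral>x. F y x \<partial>lborel) = (f 1 - f y) * k y" if "y \<in> {0..1}" for y
    using integral_inner_deriv[OF df, of y 1] that by (auto simp: F_def[abs_def])
  have Fbd: "(\<integral>x. \<bar>F y x\<bar> \<partial>lborel) \<le> C * \<bar>k y\<bar>" if "y \<in> {0..1}" for y
  proof -
    have "(\<integral>x. \<bar>F y x\<bar> \<partial>lborel) \<le> (\<integral>x. C * \<bar>k y\<bar> * indicator {0..1::real} x \<partial>lborel)"
    proof (rule Bochner_Integration.integral_mono)
      show "integrable lborel (\<lambda>x. \<bar>F y x\<bar>)" using Fx(1)[OF that] by simp
      show "integrable lborel (\<lambda>x. C * \<bar>k y\<bar> * indicator {0..1::real} x)"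
        by (intro integrable_mult_right integrable_real_indicator) auto
      show "\<bar>F y x\<bar> \<le> C * \<bar>k y\<bar> * indicator {0..1} x" for x
        using C(2)[of x] C(1) that
        by (auto simp: F_def abs_mult indicator_def intro!: mult_right_mono)
    qed
    also have "\<dots> = C * \<bar>k y\<bar>" by simp
    finally show ?thesis .
  qed
  have Fint: "integrable (\<mu> \<Otimes>\<^sub>M lborel) (case_prod F)"
  proof (rule P.Fubini_integrable[OF Fm])
    show "AE y in \<mu>. integrable lborel (\<lambda>x. case_prod F (y, x))"
      by (intro AE_I2) (use Fx in \<open>auto simp: space_mu\<close>)
    show "integrable \<mu> (\<lambda>y. \<integral>x. norm (case_prod F (y, x)) \<partial>lborel)"
    proof (rule Bochner_Integration.integrable_bound)
      show "integrable \<mu> (\<lambda>y. C * \<bar>k y\<bar>)" using k by simp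
      show "(\<lambda>y. \<integral>x. norm (case_prod F (y, x)) \<partial>lborel) \<in> borel_measurable \<mu>"
        using Fm by measurable
      show "AE y in \<mu>. norm (\<integral>x. norm (case_prod F (y, x)) \<partial>lborel) \<le> norm (C * \<bar>k y\<bar>)"
        by (intro AE_I2) (use Fbd C(1) in \<open>auto simp: space_mu abs_mult\<close>)
    qed
  qed
  have slice: "?u x * inner_deriv h' x = h' 0 * ?u x + (\<integral>y. F y x \<partial>\<mu>)" for x
  proof (cases "x \<in> {0<..<1}")
    case True
    have "(\<integral>y. F y x \<partial>\<mu>) = (\<integral>y. ?u x * (indicator {0..x} y * k y) \<partial>\<mu>)"
      by (rule Bochner_Integration.integral_cong)
         (use True in \<open>auto simp: F_def indicator_def space_mu\<close>)
    then have "(\<integral>y. F y x \<partial>\<mu>) = ?u x * (LINT y:{0..x}|\<mu>. k y)"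
      by (simp add: set_lebesgue_integral_def)
    moreover have "h' x = h' 0 + (LINT y:{0..x}|\<mu>. k y)"
      using mu_deriv2D(5)[OF dh, of x] True by simp
    ultimately show ?thesis using True by (simp add: inner_deriv_def algebra_simps)
  qed (simp add: F_def inner_deriv_def)
  have intF: "integrable lborel (\<lambda>x. \<integral>y. F y x \<partial>\<mu>)"
    using P.integrable_snd[OF Fint] by simp
  have u01: "(\<integral>x. ?u x \<partial>lborel) = f 1 - f 0"
  proof -
    have "(\<integral>x. ?u x \<partial>lborel) = (\<integral>x. indicator {0..1} x * ?u x \<partial>lborel)"
      by (rule Bochner_Integration.integral_cong) (auto simp: inner_deriv_def indicator_def)
    then show ?thesis using integral_inner_deriv(2)[OF df, of 0 1] by simp
  qed
  have "h' 1 = h' 0 + (LINT y:{0..1}|\<mu>. k y)"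
    by (rule mu_deriv2D(5)[OF dh]) simp
  also have "(LINT y:{0..1}|\<mu>. k y) = (\<integral>y. k y \<partial>\<mu>)"
    unfolding set_lebesgue_integral_def
    by (rule Bochner_Integration.integral_cong) (auto simp: space_mu)
  finally have h1: "(\<integral>y. k y \<partial>\<mu>) = h' 1 - h' 0" by simp
  have "(\<integral>x. ?u x * inner_deriv h' x \<partial>lborel) = h' 0 * (f 1 - f 0) + (\<integral>x. (\<integral>y. F y x \<partial>\<mu>) \<partial>lborel)"
    unfolding slice using intF inner_deriv_L2(2)[OF df] by (simp add: u01)
  also have "(\<integral>x. (\<integral>y. F y x \<partial>\<mu>) \<partial>lborel) = (\<integral>y. (\<integral>x. F y x \<partial>lborel) \<partial>\<mu>)"
    by (rule P.Fubini_integral[OF Fint])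
  also have "\<dots> = (\<integral>y. f 1 * k y - k y * f y \<partial>\<mu>)"
    by (rule Bochner_Integration.integral_cong) (auto simp: space_mu Fx(2) algebra_simps)
  also have "\<dots> = f 1 * (h' 1 - h' 0) - (\<integral>y. k y * f y \<partial>\<mu>)"
    using k L2_mult_integrable[OF k2 f2] by (simp add: h1)
  finally show ?thesis by (simp add: algebra_simps)
qed

end

section \<open>Energy bounds for the wave coefficients\<close>

text \<open>The Neumann term \<open>t\<close> is treated as the coefficient of the constant eigenfunction \<open>\<phi>\<^sub>1 = 1\<close>, which
  gives both boundary conditions the same form. Where \<open>\<lambda>\<^sub>k = 0\<close> the quotient evaluates to \<open>0\<close>.\<close>

definition wave_coeff :: "boundary \<Rightarrow> (nat \<Rightarrow> real) \<Rightarrow> real \<Rightarrow> nat \<Rightarrow> real" where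
  "wave_coeff bc lam t k =
     (if bc = Neumann \<and> k = 1 then t else sin (sqrt (lam k) * t) / sqrt (lam k))"

locale kf_eigenbasis = interval_measure \<mu> for \<mu> :: "real measure" +
  fixes bc :: boundary and lam :: "nat \<Rightarrow> real" and \<phi> :: "nat \<Rightarrow> real \<Rightarrow> real"
  assumes eigen: "eigenbasis bc \<mu> lam \<phi>"
begin

lemma eigen_L2: "k \<ge> 1 \<Longrightarrow> \<phi> k \<in> L2 \<mu>"
  using eigen by (simp add: eigenbasis_def)

lemma eigen_orth:
  "j \<ge> 1 \<Longrightarrow> k \<ge> 1 \<Longrightarrow> (\<integral>x. \<phi> j x * \<phi> k x \<partial>\<mu>) = (if j = k then 1 else 0)"
  using eigen by (simp add: eigenbasis_def L2_inner_def)

lemma eigen_first: "bc = Neumann \<Longrightarrow> x \<in> {0..1} \<Longrightarrow> \<phi> 1 x = 1"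
  using eigen by (simp add: eigenbasis_def)

lemma eigen_derivatives:
  obtains \<phi>' where "\<And>k. k \<ge> 1 \<Longrightarrow> mu_deriv2 \<mu> (\<phi> k) (\<phi>' k) (\<lambda>x. - (lam k * \<phi> k x))"
    and "\<And>j k. j \<ge> 1 \<Longrightarrow> k \<ge> 1 \<Longrightarrow> \<phi>' k 1 * \<phi> j 1 - \<phi>' k 0 * \<phi> j 0 = 0"
proof -
  have kf: "\<forall>k. \<exists>d. k \<ge> 1 \<longrightarrow> mu_deriv2 \<mu> (\<phi> k) d (\<lambda>x. - (lam k * \<phi> k x)) \<and>
        (case bc of Neumann \<Rightarrow> d 0 = 0 \<and> d 1 = 0 | Dirichlet \<Rightarrow> \<phi> k 0 = 0 \<and> \<phi> k 1 = 0)"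
    using eigen unfolding eigenbasis_def krein_feller_def by blast
  obtain \<phi>' where *: "\<And>k. k \<ge> 1 \<Longrightarrow> mu_deriv2 \<mu> (\<phi> k) (\<phi>' k) (\<lambda>x. - (lam k * \<phi> k x)) \<and>
        (case bc of Neumann \<Rightarrow> \<phi>' k 0 = 0 \<and> \<phi>' k 1 = 0 | Dirichlet \<Rightarrow> \<phi> k 0 = 0 \<and> \<phi> k 1 = 0)"
    using choice[OF kf] by blast
  show ?thesis
  proof (rule that)
    show "mu_deriv2 \<mu> (\<phi> k) (\<phi>' k) (\<lambda>x. - (lam k * \<phi> k x))" if "k \<ge> 1" for k
      using *[OF that] by blast
    show "\<phi>' k 1 * \<phi> j 1 - \<phi>' k 0 * \<phi> j 0 = 0" if "j \<ge> 1" "k \<ge> 1" for j k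
      using *[OF that(1)] *[OF that(2)] by (cases bc) simp_all
  qed
qed

lemma dirichlet_zero: "bc = Dirichlet \<Longrightarrow> k \<ge> 1 \<Longrightarrow> \<phi> k 0 = 0"
  using eigen by (fastforce simp: eigenbasis_def krein_feller_def)

lemma wave_coeff_sq_le:
  assumes "lam k > 0" "\<not> (bc = Neumann \<and> k = 1)"
  shows "(wave_coeff bc lam t k)\<^sup>2 \<le> 1 / lam k"
proof -
  have "(sin (sqrt (lam k) * t))\<^sup>2 \<le> 1"
    by (simp add: abs_square_le_1)
  then have "(sin (sqrt (lam k) * t) / sqrt (lam k))\<^sup>2 \<le> 1 / lam k"
    using assms(1) by (simp add: power_divide divide_right_mono)
  then show ?thesis using assms(2) by (auto simp: wave_coeff_def)
qed

text \<open>Bessel's inequality for the orthogonal family \<open>\<phi>\<^sub>k'\<close>, tested on the indicator of \<open>[x,z]\<close>, whose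
  squared norm is \<open>z - x\<close>. Indices with \<open>\<lambda>\<^sub>k = 0\<close> and the constant Neumann eigenfunction contribute
  nothing to the left-hand side, so they may be dropped before dividing by \<open>\<lambda>\<^sub>k\<close>.\<close>

lemma coeff_increment_bound_le:
  assumes xz: "0 \<le> x" "x \<le> z" "z \<le> 1" and K: "finite K" "K \<subseteq> {1..}"
  shows "(\<Sum>k\<in>K. (wave_coeff bc lam t k * (\<phi> k z - \<phi> k x))\<^sup>2) \<le> z - x"
proof -
  obtain \<phi>' where d: "\<And>k. k \<ge> 1 \<Longrightarrow> mu_deriv2 \<mu> (\<phi> k) (\<phi>' k) (\<lambda>x. - (lam k * \<phi> k x))"
    and bd: "\<And>j k. j \<ge> 1 \<Longrightarrow> k \<ge> 1 \<Longrightarrow> \<phi>' k 1 * \<phi> j 1 - \<phi>' k 0 * \<phi> j 0 = 0"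
    using eigen_derivatives by blast
  define e where "e k = inner_deriv (\<phi>' k)" for k
  have orth: "(\<integral>y. e j y * e k y \<partial>lborel) = (if j = k then lam k else 0)" if "j \<ge> 1" "k \<ge> 1" for j k
  proof -
    have "(\<integral>y. e j y * e k y \<partial>lborel) = - (\<integral>y. - (lam k * \<phi> k y) * \<phi> j y \<partial>\<mu>)"
      using energy_integration_by_parts[OF d[OF that(1)] d[OF that(2)]] bd[OF that]
      by (simp add: e_def)
    also have "\<dots> = lam k * (\<integral>y. \<phi> j y * \<phi> k y \<partial>\<mu>)"
      by (simp add: mult_ac)
    finally show ?thesis using eigen_orth[OF that] by simp
  qed
  have lam0: "lam k \<ge> 0" if "k \<ge> 1" for k
  proof -
    have "0 \<le> (\<integral>y. e k y * e k y \<partial>lborel)" by simp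
    then show ?thesis using orth[OF that that] by simp
  qed
  have incr: "(\<integral>y. indicator {x..z} y * e k y \<partial>lborel) = \<phi> k z - \<phi> k x" if "k \<ge> 1" for k
    using integral_inner_deriv(2)[OF d[OF that] xz] by (simp add: e_def)
  define K' where "K' = {k\<in>K. lam k > 0 \<and> \<not> (bc = Neumann \<and> k = 1)}"
  have K': "finite K'" "K' \<subseteq> K" "\<And>k. k \<in> K' \<Longrightarrow> k \<ge> 1" using K by (auto simp: K'_def)
  have "(\<Sum>k\<in>K. (wave_coeff bc lam t k * (\<phi> k z - \<phi> k x))\<^sup>2)
      = (\<Sum>k\<in>K'. (wave_coeff bc lam t k * (\<phi> k z - \<phi> k x))\<^sup>2)"
  proof (rule sum.mono_neutral_right[OF K(1) K'(2)], rule ballI)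
    fix k assume k: "k \<in> K - K'"
    then consider "lam k \<le> 0" "\<not> (bc = Neumann \<and> k = 1)" | "bc = Neumann" "k = 1"
      unfolding K'_def by force
    then show "(wave_coeff bc lam t k * (\<phi> k z - \<phi> k x))\<^sup>2 = 0"
    proof cases
      case 1
      then have "lam k = 0" using lam0[of k] k K(2) by auto
      then show ?thesis using 1 by (auto simp: wave_coeff_def)
    next
      case 2
      then show ?thesis using eigen_first[of x] eigen_first[of z] xz by simp
    qed
  qed
  also have "\<dots> \<le> (\<Sum>k\<in>K'. (\<integral>y. indicator {x..z} y * e k y \<partial>lborel)\<^sup>2 / lam k)"
  proof (rule sum_mono)
    fix k assume k: "k \<in> K'"
    have "(wave_coeff bc lam t k)\<^sup>2 * (\<phi> k z - \<phi> k x)\<^sup>2 \<le> 1 / lam k * (\<phi> k z - \<phi> k x)\<^sup>2"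
      by (intro mult_right_mono wave_coeff_sq_le) (use k in \<open>auto simp: K'_def\<close>)
    then show "(wave_coeff bc lam t k * (\<phi> k z - \<phi> k x))\<^sup>2
        \<le> (\<integral>y. indicator {x..z} y * e k y \<partial>lborel)\<^sup>2 / lam k"
      using incr[OF K'(3)[OF k]] by (simp add: power_mult_distrib)
  qed
  also have "\<dots> \<le> (\<integral>y. (indicator {x..z} y)\<^sup>2 \<partial>lborel)"
  proof (rule Bessel_inequality[OF K'(1)])
    show "e k \<in> L2 lborel" if "k \<in> K'" for k
      unfolding e_def by (rule inner_deriv_L2[OF d[OF K'(3)[OF that]]])
    show "indicator {x..z} \<in> L2 lborel"
      by (rule bounded_supp_L2(2)[of _ 1]) (use xz in \<open>auto simp: indicator_def\<close>)
    show "(\<integral>y. e j y * e k y \<partial>lborel) = (if j = k then lam k else 0)" if "j \<in> K'" "k \<in> K'" for j k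
      using orth K'(3) that by blast
    show "lam k > 0" if "k \<in> K'" for k using that by (simp add: K'_def)
  qed
  also have "\<dots> = z - x"
    using xz by (simp add: indicator_square)
  finally show ?thesis .
qed

lemma coeff_increment_bound:
  assumes "x \<in> {0..1}" "z \<in> {0..1}" and K: "finite K" "K \<subseteq> {1..}"
  shows "(\<Sum>k\<in>K. (wave_coeff bc lam t k * (\<phi> k z - \<phi> k x))\<^sup>2) \<le> \<bar>z - x\<bar>"
proof (cases "x \<le> z")
  case True
  then show ?thesis using coeff_increment_bound_le[of x z] assms by simp
next
  case False
  have "(wave_coeff bc lam t k * (\<phi> k z - \<phi> k x))\<^sup>2 = (wave_coeff bc lam t k * (\<phi> k x - \<phi> k z))\<^sup>2" for k
    by (simp add: power_mult_distrib power2_commute)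
  then show ?thesis using False coeff_increment_bound_le[of z x] assms by simp
qed

text \<open>By Cauchy--Schwarz, the square of an averaged increment is at most the average of the squared
  increments; the sum over \<open>k\<close> is then taken inside the average, where \<open>coeff_increment_bound\<close> applies.\<close>

lemma average_increment_bound:
  assumes x: "x \<in> {0..1}" and D: "D \<in> sets \<mu>" "measure \<mu> D > 0"
    and near: "\<And>z. z \<in> D \<Longrightarrow> \<bar>z - x\<bar> \<le> \<rho>" and K: "finite K" "K \<subseteq> {1..}"
  shows "(\<Sum>k\<in>K. (wave_coeff bc lam t k *
      ((\<integral>z. \<phi> k z * (inverse (measure \<mu> D) * indicator D z) \<partial>\<mu>) - \<phi> k x))\<^sup>2) \<le> \<rho>"
proof -
  define c where "c = measure \<mu> D"
  let ?a = "wave_coeff bc lam t"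
  have c: "c > 0" using D by (simp add: c_def)
  have iD: "(indicator D :: real \<Rightarrow> real) \<in> L2 \<mu>" by (rule L2_indicator[OF finite_measure_axioms D(1)])
  have iD2: "(\<integral>z. indicator D z \<partial>\<mu>) = c" "(\<integral>z. (indicator D z)\<^sup>2 \<partial>\<mu>) = c" "integrable \<mu> (indicator D :: real \<Rightarrow> real)"
    using D(1) L2_imp_integrable[OF iD]
    by (simp_all add: c_def indicator_square sets.Int_space_eq1 sets.Int_space_eq2)
  have dif: "(\<lambda>z. \<phi> k z - \<phi> k x) \<in> L2 \<mu>" if "k \<in> K" for k
    using eigen_L2 K that by (intro L2_diff) (auto simp: L2_def)
  have difD: "(\<lambda>z. (\<phi> k z - \<phi> k x) * indicator D z) \<in> L2 \<mu>" if "k \<in> K" for k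
  proof -
    have "integrable \<mu> (\<lambda>z. indicator D z *\<^sub>R (\<phi> k z - \<phi> k x)\<^sup>2)"
      using Bochner_Integration.integrable_mult_indicator[OF D(1) L2_square_integrable[OF dif[OF that]]] .
    moreover have "indicator D z *\<^sub>R (\<phi> k z - \<phi> k x)\<^sup>2 = ((\<phi> k z - \<phi> k x) * indicator D z)\<^sup>2" for z
      by (simp add: indicator_def)
    ultimately show ?thesis
      using D(1) L2_measurable[OF dif[OF that]] by (simp add: L2_def)
  qed
  have summand: "(?a k * ((\<integral>z. \<phi> k z * (inverse c * indicator D z) \<partial>\<mu>) - \<phi> k x))\<^sup>2
      \<le> inverse c * (\<integral>z. (?a k * (\<phi> k z - \<phi> k x) * indicator D z)\<^sup>2 \<partial>\<mu>)" if k: "k \<in> K" for k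
  proof -
    let ?J = "\<integral>z. (\<phi> k z - \<phi> k x) * indicator D z \<partial>\<mu>"
    have k1: "\<phi> k \<in> L2 \<mu>" using k K eigen_L2 by auto
    have "?J = (\<integral>z. \<phi> k z * indicator D z - \<phi> k x * indicator D z \<partial>\<mu>)"
      by (simp add: left_diff_distrib)
    also have "\<dots> = (\<integral>z. \<phi> k z * indicator D z \<partial>\<mu>) - \<phi> k x * c"
      using L2_mult_integrable[OF k1 iD] iD2 by simp
    finally have "(\<integral>z. \<phi> k z * (inverse c * indicator D z) \<partial>\<mu>) - \<phi> k x = inverse c * ?J"
      using c by (simp add: field_simps)
    moreover have "?J\<^sup>2 \<le> (\<integral>z. ((\<phi> k z - \<phi> k x) * indicator D z)\<^sup>2 \<partial>\<mu>) * c"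
    proof -
      have "?J = (\<integral>z. ((\<phi> k z - \<phi> k x) * indicator D z) * indicator D z \<partial>\<mu>)"
        by (rule Bochner_Integration.integral_cong) (auto simp: indicator_def)
      then show ?thesis using L2_Cauchy_Schwarz[OF difD[OF k] iD] iD2 by simp
    qed
    ultimately have "((\<integral>z. \<phi> k z * (inverse c * indicator D z) \<partial>\<mu>) - \<phi> k x)\<^sup>2
        \<le> inverse c * (\<integral>z. ((\<phi> k z - \<phi> k x) * indicator D z)\<^sup>2 \<partial>\<mu>)"
      using c by (simp add: power_mult_distrib field_simps power2_eq_square)
    from mult_left_mono[OF this, of "(?a k)\<^sup>2"]
    have "(?a k * ((\<integral>z. \<phi> k z * (inverse c * indicator D z) \<partial>\<mu>) - \<phi> k x))\<^sup>2
        \<le> (?a k)\<^sup>2 * (inverse c * (\<integral>z. ((\<phi> k z - \<phi> k x) * indicator D z)\<^sup>2 \<partial>\<mu>))"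
      by (simp only: power_mult_distrib[of "?a k"] zero_le_power2)
    also have "\<dots> = inverse c * (\<integral>z. (?a k)\<^sup>2 * ((\<phi> k z - \<phi> k x) * indicator D z)\<^sup>2 \<partial>\<mu>)"
      by simp
    also have "\<dots> = inverse c * (\<integral>z. (?a k * (\<phi> k z - \<phi> k x) * indicator D z)\<^sup>2 \<partial>\<mu>)"
      by (simp only: power_mult_distrib mult.assoc)
    finally show ?thesis .
  qed
  have int: "integrable \<mu> (\<lambda>z. (?a k * (\<phi> k z - \<phi> k x) * indicator D z)\<^sup>2)" if "k \<in> K" for k
    using L2_square_integrable[OF L2_cmult[OF difD[OF that], of "?a k"]] by (simp add: mult.assoc)
  have "(\<Sum>k\<in>K. (?a k * ((\<integral>z. \<phi> k z * (inverse c * indicator D z) \<partial>\<mu>) - \<phi> k x))\<^sup>2)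
      \<le> (\<Sum>k\<in>K. inverse c * (\<integral>z. (?a k * (\<phi> k z - \<phi> k x) * indicator D z)\<^sup>2 \<partial>\<mu>))"
    by (intro sum_mono summand)
  also have "\<dots> = inverse c * (\<integral>z. (\<Sum>k\<in>K. (?a k * (\<phi> k z - \<phi> k x) * indicator D z)\<^sup>2) \<partial>\<mu>)"
    using int by (subst Bochner_Integration.integral_sum) (auto simp: sum_distrib_left)
  also have "\<dots> \<le> inverse c * (\<integral>z. \<rho> * indicator D z \<partial>\<mu>)"
  proof (intro mult_left_mono Bochner_Integration.integral_mono)
    show "integrable \<mu> (\<lambda>z. \<Sum>k\<in>K. (?a k * (\<phi> k z - \<phi> k x) * indicator D z)\<^sup>2)"
      using int by auto
    show "integrable \<mu> (\<lambda>z. \<rho> * indicator D z)" using iD2 by simp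
    show "(\<Sum>k\<in>K. (?a k * (\<phi> k z - \<phi> k x) * indicator D z)\<^sup>2) \<le> \<rho> * indicator D z"
      if "z \<in> space \<mu>" for z
      using coeff_increment_bound[OF x _ K, of z t] near[of z] that
      by (cases "z \<in> D") (auto simp: space_mu)
    show "0 \<le> inverse c" using c by simp
  qed
  also have "\<dots> = \<rho>" using c iD2 by simp
  finally show ?thesis by (simp add: c_def)
qed

text \<open>An increment bound becomes a bound on the values once some reference value vanishes: the value at
  \<open>0\<close> in the Dirichlet case, and in the Neumann case the mean over \<open>[0,1]\<close>, because \<open>\<phi>\<^sub>k\<close> is orthogonal
  to \<open>\<phi>\<^sub>1 = 1\<close> for \<open>k \<ge> 2\<close>.\<close>

lemma coeff_bound:
  assumes x: "x \<in> {0..1}" and K: "finite K" "K \<subseteq> {1..}"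
  shows "(\<Sum>k\<in>K. (wave_coeff bc lam t k * \<phi> k x)\<^sup>2) \<le> 1 + t\<^sup>2"
proof (cases bc)
  case Dirichlet
  have "(\<Sum>k\<in>K. (wave_coeff bc lam t k * \<phi> k x)\<^sup>2)
      = (\<Sum>k\<in>K. (wave_coeff bc lam t k * (\<phi> k x - \<phi> k 0))\<^sup>2)"
    using dirichlet_zero[OF Dirichlet] K by (intro sum.cong) auto
  also have "\<dots> \<le> \<bar>x - 0\<bar>" by (rule coeff_increment_bound) (use assms in auto)
  also have "\<dots> \<le> 1 + t\<^sup>2" using x by (simp add: add_increasing2)
  finally show ?thesis .
next
  case Neumann
  have "(\<Sum>k\<in>K. (wave_coeff bc lam t k * \<phi> k x)\<^sup>2)
      \<le> (\<Sum>k\<in>insert 1 (K - {1}). (wave_coeff bc lam t k * \<phi> k x)\<^sup>2)"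
    by (rule sum_mono2) (use K in auto)
  also have "\<dots> = (wave_coeff bc lam t 1 * \<phi> 1 x)\<^sup>2 + (\<Sum>k\<in>K - {1}. (wave_coeff bc lam t k * \<phi> k x)\<^sup>2)"
    by (rule sum.insert) (use K in auto)
  also have "(wave_coeff bc lam t 1 * \<phi> 1 x)\<^sup>2 = t\<^sup>2"
    unfolding eigen_first[OF Neumann x] by (simp add: wave_coeff_def Neumann)
  also have "(\<Sum>k\<in>K - {1}. (wave_coeff bc lam t k * \<phi> k x)\<^sup>2)
      = (\<Sum>k\<in>K - {1}. (wave_coeff bc lam t k *
          ((\<integral>z. \<phi> k z * (inverse (measure \<mu> {0..1}) * indicator {0..1} z) \<partial>\<mu>) - \<phi> k x))\<^sup>2)"
  proof (rule sum.cong[OF refl])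
    fix k assume k: "k \<in> K - {1}"
    have "(\<integral>z. \<phi> k z * (inverse (measure \<mu> {0..1}) * indicator {0..1} z) \<partial>\<mu>)
        = (\<integral>z. \<phi> k z * \<phi> 1 z \<partial>\<mu>)"
      by (rule Bochner_Integration.integral_cong)
         (use eigen_first[OF Neumann] prob_space space_mu in auto)
    also have "\<dots> = 0" using eigen_orth[of k 1] k K by auto
    finally show "(wave_coeff bc lam t k * \<phi> k x)\<^sup>2 = (wave_coeff bc lam t k *
          ((\<integral>z. \<phi> k z * (inverse (measure \<mu> {0..1}) * indicator {0..1} z) \<partial>\<mu>) - \<phi> k x))\<^sup>2"
      by (simp add: power_mult_distrib)
  qed
  also have "\<dots> \<le> 1"
    by (rule average_increment_bound[OF x])
       (use K x prob_space space_mu sets.top[of \<mu>] in auto)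
  finally show ?thesis by simp
qed

text \<open>The square roots of the tails are equicontinuous in \<open>x\<close> by \<open>coeff_increment_bound\<close>, and at each point
  the tails tend to \<open>0\<close> by \<open>coeff_bound\<close>; hence it suffices to control them on a grid of mesh \<open>1/M\<close>. As
  \<open>(u + v)\<^sup>2 \<le> 2 u\<^sup>2 + 2 v\<^sup>2\<close>, the grid values and the mesh may each use up \<open>\<epsilon>/4\<close>.\<close>

lemma coeff_tail_uniform:
  assumes "\<epsilon> > 0"
  obtains n0 where "\<And>m n x. m \<ge> n0 \<Longrightarrow> x \<in> {0..1} \<Longrightarrow>
    (\<Sum>k=Suc m..n. (wave_coeff bc lam t k * \<phi> k x)\<^sup>2) \<le> \<epsilon>"
proof -
  let ?a = "wave_coeff bc lam t"
  define M where "M = Suc (nat \<lceil>4 / \<epsilon>\<rceil>)"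
  have M: "real M \<ge> 4 / \<epsilon>" "M > 0" unfolding M_def by (simp_all, linarith)
  have "\<exists>n0. \<forall>m\<ge>n0. \<forall>n. (\<Sum>k=Suc m..n. (?a k * \<phi> k (real i / M))\<^sup>2) \<le> \<epsilon> / 4" if i: "i \<le> M" for i
  proof -
    let ?f = "\<lambda>k. if k = 0 then 0 else (?a k * \<phi> k (real i / M))\<^sup>2"
    have z: "real i / M \<in> {0..1}" using i M by simp
    have "summable ?f"
    proof (rule summableI_nonneg_bounded)
      show "0 \<le> ?f k" for k by simp
      show "sum ?f {..<n} \<le> 1 + t\<^sup>2" for n
      proof -
        have "sum ?f {..<n} = (\<Sum>k\<in>{..<n} - {0}. (?a k * \<phi> k (real i / M))\<^sup>2)"
          by (rule sum.mono_neutral_cong_right) auto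
        also have "\<dots> \<le> 1 + t\<^sup>2"
          by (rule coeff_bound[OF z]) auto
        finally show ?thesis .
      qed
    qed
    moreover have "\<epsilon> / 4 > 0" using assms by simp
    ultimately obtain n0 where n0: "\<And>m n. m \<ge> n0 \<Longrightarrow> norm (sum ?f {m..n}) < \<epsilon> / 4"
      using summable_partial_sum_bound by blast
    have "(\<Sum>k=Suc m..n. (?a k * \<phi> k (real i / M))\<^sup>2) \<le> \<epsilon> / 4" if "m \<ge> n0" for m n
    proof -
      have "(\<Sum>k=Suc m..n. (?a k * \<phi> k (real i / M))\<^sup>2) = sum ?f {Suc m..n}"
        by (rule sum.cong) auto
      then show ?thesis using n0[of "Suc m" n] that by simp
    qed
    then show ?thesis by blast
  qed
  then obtain n1 where n1: "\<And>i m n. i \<le> M \<Longrightarrow> m \<ge> n1 i \<Longrightarrow>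
      (\<Sum>k=Suc m..n. (?a k * \<phi> k (real i / M))\<^sup>2) \<le> \<epsilon> / 4"
    by metis
  show ?thesis
  proof (rule that[of "Max (n1 ` {..M})"])
    fix m n x assume m: "m \<ge> Max (n1 ` {..M})" and x: "x \<in> {0..(1::real)}"
    define i where "i = nat \<lfloor>x * M\<rfloor>"
    define z where "z = real i / M"
    have i: "real i \<le> x * M" "x * M < real i + 1"
      unfolding i_def using x M by (auto intro: floor_less_iff simp: mult_nonneg_nonneg)
    have "x * M \<le> M" using x by (simp add: mult_left_le_one_le)
    then have iM: "i \<le> M" using i by linarith
    have z: "z \<in> {0..1}" using iM M by (simp add: z_def)
    have "x - z = (x * M - real i) / M" using M by (simp add: z_def field_simps)
    then have "\<bar>x - z\<bar> = \<bar>x * M - real i\<bar> / M" by (simp add: abs_divide)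
    also have "\<dots> \<le> 1 / M" by (rule divide_right_mono) (use i in auto)
    also have "\<dots> \<le> \<epsilon> / 4" using M assms by (simp add: field_simps)
    finally have near: "\<bar>x - z\<bar> \<le> \<epsilon> / 4" .
    have "(?a k * \<phi> k x)\<^sup>2 \<le> 2 * (?a k * \<phi> k z)\<^sup>2 + 2 * (?a k * (\<phi> k x - \<phi> k z))\<^sup>2" for k
    proof -
      have "(u + v)\<^sup>2 \<le> 2 * u\<^sup>2 + 2 * v\<^sup>2" for u v :: real
        using sum_squares_bound[of u v] by (simp add: power2_sum)
      from this[of "?a k * \<phi> k z" "?a k * (\<phi> k x - \<phi> k z)"] show ?thesis
        by (simp add: right_diff_distrib)
    qed
    then have "(\<Sum>k=Suc m..n. (?a k * \<phi> k x)\<^sup>2)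
        \<le> 2 * (\<Sum>k=Suc m..n. (?a k * \<phi> k z)\<^sup>2) + 2 * (\<Sum>k=Suc m..n. (?a k * (\<phi> k x - \<phi> k z))\<^sup>2)"
      by (simp add: sum_distrib_left sum.distrib[symmetric] sum_mono)
    also have "(\<Sum>k=Suc m..n. (?a k * (\<phi> k x - \<phi> k z))\<^sup>2) \<le> \<epsilon> / 4"
      using coeff_increment_bound[OF z x, of "{Suc m..n}" t] near by auto
    also have "(\<Sum>k=Suc m..n. (?a k * \<phi> k z)\<^sup>2) \<le> \<epsilon> / 4"
    proof -
      have "n1 i \<le> Max (n1 ` {..M})" using iM by simp
      then show ?thesis using n1[OF iM, of m n] m by (simp add: z_def)
    qed
    finally show "(\<Sum>k=Suc m..n. (?a k * \<phi> k x)\<^sup>2) \<le> \<epsilon>" by simp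
  qed
qed

end

section \<open>Existence of the propagator and its averages\<close>

definition kernel_sum ::
  "(nat \<Rightarrow> real) \<Rightarrow> (nat \<Rightarrow> real \<Rightarrow> real) \<Rightarrow> nat \<Rightarrow> real \<Rightarrow> real \<Rightarrow> real" where
  "kernel_sum a \<phi> n x y = (\<Sum>k=1..n. (a k * \<phi> k x) * \<phi> k y)"

lemma kernel_sum_commute: "kernel_sum a \<phi> n x y = kernel_sum a \<phi> n y x"
  by (simp add: kernel_sum_def mult_ac)

context kf_eigenbasis
begin

lemma wave_partial_kernel_sum:
  assumes "n \<ge> 1" "x \<in> {0..1}" "y \<in> {0..1}"
  shows "wave_partial bc lam \<phi> n t x y = kernel_sum (wave_coeff bc lam t) \<phi> n x y"
proof (cases bc)
  case Dirichlet
  then show ?thesis by (simp add: wave_partial_def kernel_sum_def wave_coeff_def)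
next
  case Neumann
  have "kernel_sum (wave_coeff bc lam t) \<phi> n x y
      = wave_coeff bc lam t 1 * \<phi> 1 x * \<phi> 1 y
        + (\<Sum>k=2..n. wave_coeff bc lam t k * \<phi> k x * \<phi> k y)"
    using assms(1) by (simp add: kernel_sum_def sum.atLeast_Suc_atMost numeral_2_eq_2)
  also have "wave_coeff bc lam t 1 * \<phi> 1 x * \<phi> 1 y = t"
    unfolding eigen_first[OF Neumann assms(2)] eigen_first[OF Neumann assms(3)]
    by (simp add: wave_coeff_def Neumann)
  also have "(\<Sum>k=2..n. wave_coeff bc lam t k * \<phi> k x * \<phi> k y)
      = (\<Sum>k=2..n. sin (sqrt (lam k) * t) / sqrt (lam k) * \<phi> k x * \<phi> k y)"
    by (rule sum.cong) (auto simp: wave_coeff_def)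
  finally show ?thesis by (simp add: wave_partial_def Neumann)
qed

lemma eigen_sum_L2:
  assumes "K \<subseteq> {1..}"
  shows "(\<lambda>y. \<Sum>k\<in>K. d k * \<phi> k y) \<in> L2 \<mu>"
  by (rule L2_sum) (use assms eigen_L2 in auto)

lemma kernel_sum_L2: "kernel_sum a \<phi> n x \<in> L2 \<mu>"
  unfolding kernel_sum_def[abs_def] by (rule eigen_sum_L2) auto

lemma eigen_sum_norm:
  assumes "finite K" "K \<subseteq> {1..}"
  shows "(\<integral>y. (\<Sum>k\<in>K. d k * \<phi> k y)\<^sup>2 \<partial>\<mu>) = (\<Sum>k\<in>K. (d k)\<^sup>2)"
proof -
  have ge: "k \<ge> 1" if "k \<in> K" for k using assms that by auto
  have "(\<integral>y. (\<Sum>k\<in>K. d k * \<phi> k y)\<^sup>2 \<partial>\<mu>) = (\<Sum>k\<in>K. (d k)\<^sup>2 * 1)"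
    by (rule orthogonal_sum_square_integral[OF assms(1) eigen_L2[OF ge] eigen_orth[OF ge ge]])
  then show ?thesis by simp
qed

lemma kernel_sum_diff_norm:
  assumes "m \<le> n"
  shows "(\<integral>y. (kernel_sum a \<phi> n x y - kernel_sum a \<phi> m x y)\<^sup>2 \<partial>\<mu>) = (\<Sum>k=Suc m..n. (a k * \<phi> k x)\<^sup>2)"
proof -
  have "kernel_sum a \<phi> n x y - kernel_sum a \<phi> m x y = (\<Sum>k=Suc m..n. (a k * \<phi> k x) * \<phi> k y)" for y
  proof -
    have "{1..n} = {1..m} \<union> {Suc m..n}" using assms by auto
    then have "kernel_sum a \<phi> n x y = kernel_sum a \<phi> m x y + (\<Sum>k=Suc m..n. (a k * \<phi> k x) * \<phi> k y)"
      unfolding kernel_sum_def by (simp only:, subst sum.union_disjoint) auto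
    then show ?thesis by simp
  qed
  then show ?thesis by (simp add: eigen_sum_norm)
qed

text \<open>The exceptional null set in \<open>y\<close> depends on \<open>x\<close>, so choosing an \<open>L\<^sup>2\<close>-representative for each \<open>x\<close>
  separately gives no control over the sections in the other variable. The pointwise limit along a
  subsequence that works for every \<open>x\<close> is a symmetric function, for which both kinds of sections
  are the same.\<close>

lemma wave_kernel_exists:
  obtains p :: "real \<Rightarrow> real \<Rightarrow> real" where "\<And>x y. p x y = p y x"
    and "\<And>x. x \<in> {0..1} \<Longrightarrow> L2_tendsto \<mu> (\<lambda>n. kernel_sum (wave_coeff bc lam t) \<phi> n x) (p x)"
proof -
  let ?S = "kernel_sum (wave_coeff bc lam t) \<phi>"
  have "\<forall>j. \<exists>n0. \<forall>m n x. m \<ge> n0 \<longrightarrow> x \<in> {0..1} \<longrightarrow>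
      (\<Sum>k=Suc m..n. (wave_coeff bc lam t k * \<phi> k x)\<^sup>2) \<le> (1/4) ^ j"
  proof
    fix j :: nat
    have "(1/4 :: real) ^ j > 0" by simp
    then obtain n0 where "\<And>m n x. m \<ge> n0 \<Longrightarrow> x \<in> {0..1} \<Longrightarrow>
      (\<Sum>k=Suc m..n. (wave_coeff bc lam t k * \<phi> k x)\<^sup>2) \<le> (1/4) ^ j"
      using coeff_tail_uniform[of "(1/4) ^ j" t] by blast
    then show "\<exists>n0. \<forall>m n x. m \<ge> n0 \<longrightarrow> x \<in> {0..1} \<longrightarrow>
      (\<Sum>k=Suc m..n. (wave_coeff bc lam t k * \<phi> k x)\<^sup>2) \<le> (1/4) ^ j" by blast
  qed
  then obtain n0 where n0: "\<And>j m n x. m \<ge> n0 j \<Longrightarrow> x \<in> {0..1} \<Longrightarrow>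
      (\<Sum>k=Suc m..n. (wave_coeff bc lam t k * \<phi> k x)\<^sup>2) \<le> (1/4) ^ j"
    by metis
  have cauchy: "(\<integral>y. (?S n x y - ?S m x y)\<^sup>2 \<partial>\<mu>) \<le> (1/4) ^ j"
    if "n0 j \<le> m" "m \<le> n" "x \<in> {0..1}" for j m n x
    using n0[OF that(1,3)] by (simp add: kernel_sum_diff_norm[OF that(2)])
  \<comment> \<open>summing makes the indices strictly increasing while keeping \<open>r j \<ge> n0 j\<close>\<close>
  define r where "r j = (\<Sum>i\<le>j. Suc (n0 i))" for j
  have r: "strict_mono r" unfolding strict_mono_Suc_iff by (simp add: r_def)
  have rn0: "n0 j \<le> r j" for j
    unfolding r_def by (rule order_trans[OF le_SucI[OF order_refl]], rule member_le_sum) auto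
  define p where "p x y = lim (\<lambda>j. ?S (r j) x y)" for x y
  have "p x y = p y x" for x y
    unfolding p_def by (subst kernel_sum_commute) simp
  moreover have "L2_tendsto \<mu> (\<lambda>n. ?S n x) (p x)" if x: "x \<in> {0..1}" for x
  proof -
    have Sm [measurable]: "?S n x \<in> borel_measurable \<mu>" for n
      by (rule L2_measurable[OF kernel_sum_L2])
    have pm: "p x \<in> borel_measurable \<mu>"
      unfolding p_def[abs_def] by (rule borel_measurable_lim_metric) (rule Sm)
    have "AE y in \<mu>. convergent (\<lambda>j. ?S (r j) x y)"
      by (rule AE_convergent_fast_L2)
         (use prob_space_axioms kernel_sum_L2 cauchy[OF rn0 _ x] strict_mono_leD[OF r] in auto)
    then have lim: "AE y in \<mu>. (\<lambda>j. ?S (r j) x y) \<longlonglongrightarrow> p x y"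
      by eventually_elim (simp add: p_def convergent_LIMSEQ_iff)
    have tail: "(\<lambda>y. p x y - ?S n x y) \<in> L2 \<mu> \<and> (\<integral>y. (p x y - ?S n x y)\<^sup>2 \<partial>\<mu>) \<le> (1/4) ^ j"
      if n: "n \<ge> n0 j" for n j
    proof -
      have "AE y in \<mu>. (\<lambda>i. ?S (r i) x y - ?S n x y) \<longlonglongrightarrow> p x y - ?S n x y"
        using lim by eventually_elim (intro tendsto_intros)
      moreover have "\<forall>\<^sub>F i in sequentially. (\<integral>y. (?S (r i) x y - ?S n x y)\<^sup>2 \<partial>\<mu>) \<le> (1/4) ^ j"
        using eventually_ge_at_top[of n]
      proof eventually_elim
        case (elim i)
        then show ?case using cauchy[OF n _ x] seq_suble[OF r, of i] by simp
      qed
      moreover have "(\<lambda>y. p x y - ?S n x y) \<in> borel_measurable \<mu>" using pm by measurable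
      moreover have "(\<lambda>y. ?S (r i) x y - ?S n x y) \<in> L2 \<mu>" for i
        by (intro L2_diff kernel_sum_L2)
      ultimately show ?thesis
        using L2_Fatou[of "\<lambda>i y. ?S (r i) x y - ?S n x y" \<mu> "\<lambda>y. p x y - ?S n x y"] by blast
    qed
    have pL2: "p x \<in> L2 \<mu>"
      using L2_add[OF conjunct1[OF tail[OF order_refl[of "n0 0"]]]
          kernel_sum_L2[of "wave_coeff bc lam t" "n0 0" x]] by simp
    have "(\<lambda>n. \<integral>y. (?S n x y - p x y)\<^sup>2 \<partial>\<mu>) \<longlonglongrightarrow> 0"
    proof (rule LIMSEQ_I)
      fix e :: real assume "0 < e"
      then obtain j where j: "(1/4 :: real) ^ j < e"
        using real_arch_pow_inv[of e "1/4"] by auto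
      have "norm ((\<integral>y. (?S n x y - p x y)\<^sup>2 \<partial>\<mu>) - 0) < e" if "n \<ge> n0 j" for n
        using conjunct2[OF tail[OF that]] j by (simp add: power2_commute[of "?S n x _"])
      then show "\<exists>no. \<forall>n\<ge>no. norm ((\<integral>y. (?S n x y - p x y)\<^sup>2 \<partial>\<mu>) - 0) < e" by blast
    qed
    then show ?thesis using pL2 kernel_sum_L2 by (simp add: L2_tendsto_def)
  qed
  ultimately show ?thesis using that by blast
qed

lemma wave_partial_L2:
  assumes "x \<in> {0..1}"
  shows "wave_partial bc lam \<phi> n t x \<in> L2 \<mu>"
proof (cases "n = 0")
  case True
  then have "wave_partial bc lam \<phi> n t x = (\<lambda>y. case bc of Dirichlet \<Rightarrow> 0 | Neumann \<Rightarrow> t)"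
    by (cases bc) (auto simp: wave_partial_def fun_eq_iff)
  then show ?thesis using L2_const[OF finite_measure_axioms] by simp
next
  case False
  then show ?thesis
    using L2_cong[of \<mu> "wave_partial bc lam \<phi> n t x"] wave_partial_kernel_sum[OF _ assms] kernel_sum_L2
    by (simp add: space_mu)
qed

lemma wave_partial_tendsto:
  assumes x: "x \<in> {0..1}"
    and p: "L2_tendsto \<mu> (\<lambda>n. kernel_sum (wave_coeff bc lam t) \<phi> n x) p"
  shows "L2_tendsto \<mu> (\<lambda>n. wave_partial bc lam \<phi> n t x) p"
proof -
  let ?S = "kernel_sum (wave_coeff bc lam t) \<phi>"
  have "(\<lambda>n. \<integral>y. (?S n x y - p y)\<^sup>2 \<partial>\<mu>) \<longlonglongrightarrow> 0" using p by (simp add: L2_tendsto_def)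
  moreover have "\<forall>\<^sub>F n in sequentially.
      (\<integral>y. (?S n x y - p y)\<^sup>2 \<partial>\<mu>) = (\<integral>y. (wave_partial bc lam \<phi> n t x y - p y)\<^sup>2 \<partial>\<mu>)"
    using eventually_ge_at_top[of 1]
    by eventually_elim
       (auto intro!: Bochner_Integration.integral_cong simp: space_mu wave_partial_kernel_sum[OF _ x])
  ultimately have "(\<lambda>n. \<integral>y. (wave_partial bc lam \<phi> n t x y - p y)\<^sup>2 \<partial>\<mu>) \<longlonglongrightarrow> 0"
    by (rule Lim_transform_eventually)
  then show ?thesis using p wave_partial_L2[OF x] by (simp add: L2_tendsto_def)
qed

lemma wave_partial_commute: "wave_partial bc lam \<phi> n t x y = wave_partial bc lam \<phi> n t y x"
  by (cases bc) (simp_all add: wave_partial_def mult_ac)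

lemma wave_propagator_exists: "\<exists>P. wave_propagator bc \<mu> lam \<phi> P"
proof -
  have "\<forall>t. \<exists>p. (\<forall>x y. p x y = p y x) \<and>
      (\<forall>x\<in>{0..1}. L2_tendsto \<mu> (\<lambda>n. kernel_sum (wave_coeff bc lam t) \<phi> n x) (p x))"
    using wave_kernel_exists by metis
  then obtain P where sym: "\<And>t x y. P t x y = P t y x" and
    lim: "\<And>t x. x \<in> {0..1} \<Longrightarrow> L2_tendsto \<mu> (\<lambda>n. kernel_sum (wave_coeff bc lam t) \<phi> n x) (P t x)"
    by metis
  have *: "L2_tendsto \<mu> (\<lambda>n. wave_partial bc lam \<phi> n t x) (P t x)" if "x \<in> {0..1}" for t x
    by (rule wave_partial_tendsto[OF that lim[OF that]])
  have "L2_tendsto \<mu> (\<lambda>n x. wave_partial bc lam \<phi> n t x y) (\<lambda>x. P t x y)" if "y \<in> {0..1}" for t y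
    using *[OF that, of t] by (subst wave_partial_commute, subst sym)
  then show ?thesis using * unfolding wave_propagator_def by blast
qed

text \<open>For every \<open>y\<close> the average of \<open>P(t,\<cdot>,y)\<close> is the limit of the series with \<open>\<phi>\<^sub>k(x)\<close> replaced by the average
  \<open>F\<^sub>k\<close> of \<open>\<phi>\<^sub>k\<close>, since integration against \<open>f\<close> is a continuous functional on \<open>L\<^sup>2\<close>; and \<open>P(t,x,y)\<close> is the
  limit of the original series along a subsequence, for almost every \<open>y\<close>. The difference of the partial
  sums has squared norm \<open>\<Sum> a\<^sub>k\<^sup>2 (F\<^sub>k - \<phi>\<^sub>k(x))\<^sup>2 \<le> \<rho>\<close>, and Fatou's lemma carries this to the limit.\<close>

lemma propagator_average_error:
  assumes P: "wave_propagator bc \<mu> lam \<phi> P" and t: "t \<ge> 0" and x: "x \<in> {0..1}"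
    and D: "D \<in> sets \<mu>" "measure \<mu> D > 0"
    and near: "\<And>z. z \<in> D \<Longrightarrow> \<bar>z - x\<bar> \<le> \<rho>"
  defines "f \<equiv> \<lambda>z. inverse (measure \<mu> D) * indicator D z"
  shows "(\<lambda>y. L2_inner \<mu> (\<lambda>z. P t z y) f - P t x y) \<in> L2 \<mu>"
    and "(\<integral>y. (L2_inner \<mu> (\<lambda>z. P t z y) f - P t x y)\<^sup>2 \<partial>\<mu>) \<le> \<rho>"
proof -
  let ?a = "wave_coeff bc lam t" and ?W = "wave_partial bc lam \<phi>"
  have f: "f \<in> L2 \<mu>"
    unfolding f_def by (intro L2_cmult L2_indicator[OF finite_measure_axioms D(1)])
  have PL: "L2_tendsto \<mu> (\<lambda>n. ?W n t x) (P t x)"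
    using P t x by (simp add: wave_propagator_def)
  define F where "F k = (\<integral>z. \<phi> k z * f z \<partial>\<mu>)" for k
  define Q where "Q y = L2_inner \<mu> (\<lambda>z. P t z y) f" for y
  define q where "q n y = (\<Sum>k=1..n. (?a k * F k) * \<phi> k y)" for n y
  have qQ: "(\<lambda>n. q n y) \<longlonglongrightarrow> Q y" if y: "y \<in> {0..1}" for y
  proof -
    have "L2_tendsto \<mu> (\<lambda>n z. ?W n t z y) (\<lambda>z. P t z y)"
      using P t y by (simp add: wave_propagator_def)
    then have "(\<lambda>n. L2_inner \<mu> (\<lambda>z. ?W n t z y) f) \<longlonglongrightarrow> Q y"
      unfolding Q_def by (rule L2_tendsto_inner[OF _ f])
    moreover have "\<forall>\<^sub>F n in sequentially. L2_inner \<mu> (\<lambda>z. ?W n t z y) f = q n y"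
      using eventually_ge_at_top[of 1]
    proof eventually_elim
      case (elim n)
      have "L2_inner \<mu> (\<lambda>z. ?W n t z y) f = (\<integral>z. (\<Sum>k=1..n. (?a k * \<phi> k y) * (\<phi> k z * f z)) \<partial>\<mu>)"
        unfolding L2_inner_def
        by (rule Bochner_Integration.integral_cong)
           (use elim y in \<open>auto simp: space_mu wave_partial_kernel_sum kernel_sum_def sum_distrib_left mult_ac\<close>)
      also have "\<dots> = (\<Sum>k=1..n. (?a k * \<phi> k y) * F k)"
        unfolding F_def using L2_mult_integrable[OF eigen_L2 f]
        by (subst Bochner_Integration.integral_sum) auto
      finally show ?case by (simp add: q_def mult_ac)
    qed
    ultimately show ?thesis by (rule Lim_transform_eventually)
  qed
  have qL2: "q n \<in> L2 \<mu>" for n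
    unfolding q_def[abs_def] by (rule eigen_sum_L2) auto
  have Qm: "Q \<in> borel_measurable \<mu>"
    by (rule borel_measurable_LIMSEQ_real[of _ q]) (use qQ qL2 L2_measurable space_mu in auto)
  have Pm: "P t x \<in> borel_measurable \<mu>"
    using PL by (auto simp: L2_tendsto_def L2_def)
  obtain r where r: "strict_mono r" and rP: "AE y in \<mu>. (\<lambda>n. ?W (r n) t x y) \<longlonglongrightarrow> P t x y"
    using L2_tendsto_AE_subseq[OF finite_measure_axioms PL] .
  define s where "s n y = (\<Sum>k=1..r n. (?a k * (F k - \<phi> k x)) * \<phi> k y)" for n y
  have s_eq: "s n y = q (r n) y - ?W (r n) t x y" if "n \<ge> 1" "y \<in> {0..1}" for n y
  proof -
    have "r n \<ge> 1" using seq_suble[OF r, of n] that(1) by simp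
    then show ?thesis using that x
      by (simp add: s_def q_def wave_partial_kernel_sum kernel_sum_def algebra_simps flip: sum_subtractf)
  qed
  have "s n \<in> L2 \<mu>" for n
    unfolding s_def[abs_def] by (rule eigen_sum_L2) auto
  moreover have "AE y in \<mu>. (\<lambda>n. s n y) \<longlonglongrightarrow> Q y - P t x y"
    using rP AE_space
  proof eventually_elim
    case (elim y)
    then have y: "y \<in> {0..1}" by (simp add: space_mu)
    have "(\<lambda>n. q (r n) y) \<longlonglongrightarrow> Q y"
      using LIMSEQ_subseq_LIMSEQ[OF qQ[OF y] r] by (simp add: o_def)
    then have "(\<lambda>n. q (r n) y - ?W (r n) t x y) \<longlonglongrightarrow> Q y - P t x y"
      using elim(1) by (rule tendsto_diff)
    moreover have "\<forall>\<^sub>F n in sequentially. q (r n) y - ?W (r n) t x y = s n y"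
      using eventually_ge_at_top[of 1] by eventually_elim (rule s_eq[OF _ y, symmetric])
    ultimately show ?case by (rule Lim_transform_eventually)
  qed
  moreover have "\<forall>\<^sub>F n in sequentially. (\<integral>y. (s n y)\<^sup>2 \<partial>\<mu>) \<le> \<rho>"
  proof (rule always_eventually, rule allI)
    fix n
    have "(\<integral>y. (s n y)\<^sup>2 \<partial>\<mu>) = (\<Sum>k=1..r n. (?a k * (F k - \<phi> k x))\<^sup>2)"
      unfolding s_def by (rule eigen_sum_norm) auto
    also have "\<dots> \<le> \<rho>"
      unfolding F_def f_def by (rule average_increment_bound[OF x D near]) auto
    finally show "(\<integral>y. (s n y)\<^sup>2 \<partial>\<mu>) \<le> \<rho>" .
  qed
  moreover have "(\<lambda>y. Q y - P t x y) \<in> borel_measurable \<mu>"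
    using Qm Pm by measurable
  ultimately show "(\<lambda>y. L2_inner \<mu> (\<lambda>z. P t z y) f - P t x y) \<in> L2 \<mu>"
    and "(\<integral>y. (L2_inner \<mu> (\<lambda>z. P t z y) f - P t x y)\<^sup>2 \<partial>\<mu>) \<le> \<rho>"
    using L2_Fatou[of s \<mu> "\<lambda>y. Q y - P t x y" \<rho>] unfolding Q_def by blast+
qed

end

section \<open>Cells of the self-similar set\<close>

locale ifs_measure = interval_measure \<mu> for \<mu> :: "real measure" +
  fixes N :: nat and r b m :: "nat \<Rightarrow> real"
  assumes ifs: "interval_ifs N r b"
    and weights: "prob_weights N m"
    and self_similar: "self_similar_measure N r b m \<mu>"
begin

lemma ratio_bounds: "i \<in> {1..N} \<Longrightarrow> 0 < r i" "i \<in> {1..N} \<Longrightarrow> r i < 1"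
  using ifs by (auto simp: interval_ifs_def)

lemma ratio_le_r_max: "i \<in> {1..N} \<Longrightarrow> r i \<le> r_max N r"
  by (simp add: r_max_def)

lemma r_max_bounds: "0 < r_max N r" "r_max N r < 1"
proof -
  have "N \<ge> 2" using ifs by (simp add: interval_ifs_def)
  then have "r_max N r \<in> r ` {1..N}" unfolding r_max_def by (intro Max_in) auto
  then show "0 < r_max N r" "r_max N r < 1" using ratio_bounds by auto
qed

lemma similitude_unit:
  assumes "i \<in> {1..N}" "x \<in> {0..1}"
  shows "similitude r b i x \<in> {0..1}"
proof -
  have *: "0 < r i" "0 \<le> b i" "b i \<le> 1 - r i"
    using ifs assms(1) by (auto simp: interval_ifs_def)
  have "r i * x \<le> r i" "0 \<le> r i * x" using * assms(2) by (simp_all add: mult_left_le)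
  then show ?thesis using * unfolding similitude_def atLeastAtMost_iff by (intro conjI) linarith+
qed

lemma similitude_vimage_image:
  assumes "i \<in> {1..N}" "A \<subseteq> {0..1}"
  shows "similitude r b i -` (similitude r b i ` A) \<inter> {0..1} = A"
  using ratio_bounds(1)[OF assms(1)] assms(2) by (auto simp: similitude_def)

lemma continuous_similitude: "continuous_on A (similitude r b i)"
  unfolding similitude_def[abs_def] by (intro continuous_intros)

lemma measure_self_similar:
  assumes "A \<in> sets \<mu>"
  shows "measure \<mu> A = (\<Sum>i=1..N. m i * measure \<mu> (similitude r b i -` A \<inter> {0..1}))"
  using self_similar assms unfolding self_similar_measure_def by blast

lemma weight_pos: "i \<in> {1..N} \<Longrightarrow> 0 < m i"
  using weights by (simp add: prob_weights_def)

lemma supp_subset: "supp \<mu> \<subseteq> {0..1}"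
  by (auto simp: supp_def space_mu)

lemma supp_complement:
  "{0..1} - supp \<mu> = \<Union>{U. open U \<and> measure \<mu> (U \<inter> {0..1}) = 0} \<inter> {0..1}"
  unfolding supp_def space_mu using measure_nonneg[of \<mu>] by (fastforce simp: less_le)

lemma compact_supp: "compact (supp \<mu>)"
proof -
  have "supp \<mu> = {0..1} - \<Union>{U. open U \<and> measure \<mu> (U \<inter> {0..1}) = 0}"
    using supp_complement supp_subset by blast
  moreover have "open (\<Union>{U. open U \<and> measure \<mu> (U \<inter> {0..1}) = 0})" by blast
  ultimately show ?thesis using compact_diff[OF compact_Icc] by metis
qed

lemma compact_in_sets: "compact K \<Longrightarrow> K \<subseteq> {0..1} \<Longrightarrow> K \<in> sets \<mu>"
  by (rule borel_in_sets_mu) (simp add: borel_compact)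

text \<open>The complement of the support is covered by open null sets, countably many of which suffice by
  second countability.\<close>

lemma measure_supp: "measure \<mu> (supp \<mu>) = 1"
proof -
  let ?F = "{U. open U \<and> measure \<mu> (U \<inter> {0..1}) = 0}"
  obtain F' where F': "F' \<subseteq> ?F" "countable F'" "\<Union>F' = \<Union>?F"
    using Lindelof[of ?F] by auto
  have "(\<Union>U\<in>F'. U \<inter> {0..1}) \<in> null_sets \<mu>"
  proof (rule null_sets_UN'[OF F'(2)])
    fix U assume "U \<in> F'"
    then have U: "open U" "measure \<mu> (U \<inter> {0..1}) = 0" using F'(1) by auto
    have "U \<inter> {0..1} \<in> sets \<mu>" by (rule borel_in_sets_mu) (use U in auto)
    then show "U \<inter> {0..1} \<in> null_sets \<mu>"
      using U(2) by (simp add: null_sets_def emeasure_eq_measure)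
  qed
  moreover have "(\<Union>U\<in>F'. U \<inter> {0..1}) = space \<mu> - supp \<mu>"
    unfolding space_mu supp_complement F'(3)[symmetric] by blast
  ultimately have "measure \<mu> (space \<mu> - supp \<mu>) = 0"
    by (simp add: null_sets_def measure_def)
  then show ?thesis
    using prob_compl[OF compact_in_sets[OF compact_supp supp_subset]] by simp
qed

text \<open>The images \<open>S\<^sub>i(F)\<close> are compact. A point outside all of them has a neighbourhood \<open>U\<close> missing them,
  so each preimage of \<open>U\<close> under an \<open>S\<^sub>i\<close> misses \<open>F\<close> and is null; by self-similarity \<open>U\<close> is null as well.\<close>

lemma supp_preimage:
  assumes x: "x \<in> supp \<mu>"
  shows "\<exists>i\<in>{1..N}. x \<in> similitude r b i ` supp \<mu>"
proof (rule ccontr)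
  assume no: "\<not> ?thesis"
  let ?C = "\<lambda>i. similitude r b i ` supp \<mu>"
  define U where "U = - (\<Union>i\<in>{1..N}. ?C i)"
  have xU: "x \<in> U" using no by (simp add: U_def)
  have "compact (?C i)" for i
    by (rule compact_continuous_image[OF continuous_similitude compact_supp])
  then have "closed (\<Union>i\<in>{1..N}. ?C i)"
    by (intro closed_UN) (auto intro: compact_imp_closed)
  then have oU: "open U" unfolding U_def by (rule open_Compl)
  have UA: "U \<inter> {0..1} \<in> sets \<mu>" by (rule borel_in_sets_mu) (use oU in auto)
  have "measure \<mu> (similitude r b i -` (U \<inter> {0..1}) \<inter> {0..1}) = 0" if i: "i \<in> {1..N}" for i
  proof -
    have "measure \<mu> (similitude r b i -` (U \<inter> {0..1}) \<inter> {0..1}) \<le> measure \<mu> (space \<mu> - supp \<mu>)"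
    proof (rule finite_measure_mono)
      show "similitude r b i -` (U \<inter> {0..1}) \<inter> {0..1} \<subseteq> space \<mu> - supp \<mu>"
        using i by (auto simp: U_def space_mu)
      show "space \<mu> - supp \<mu> \<in> sets \<mu>"
        using compact_in_sets[OF compact_supp supp_subset] by blast
    qed
    also have "\<dots> = 0"
      using prob_compl[OF compact_in_sets[OF compact_supp supp_subset]] measure_supp by simp
    finally show ?thesis using measure_nonneg[of \<mu>] by (simp add: order_antisym)
  qed
  then have "measure \<mu> (U \<inter> {0..1}) = 0"
    by (subst measure_self_similar[OF UA]) simp
  then show False using x oU xU by (auto simp: supp_def space_mu)
qed

lemma word_map_Cons: "word_map r b (i # w) x = similitude r b i (word_map r b w x)"
  by (simp add: word_map_def)

lemma word_map_unit:
  "set w \<subseteq> {1..N} \<Longrightarrow> x \<in> {0..1} \<Longrightarrow> word_map r b w x \<in> {0..1}"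
  by (induction w) (use similitude_unit in \<open>auto simp: word_map_def\<close>)

lemma word_map_dist: "set w \<subseteq> {1..N} \<Longrightarrow>
  \<bar>word_map r b w u - word_map r b w v\<bar> = word_ratio r w * \<bar>u - v\<bar>"
proof (induction w)
  case (Cons i w)
  have "word_map r b (i # w) u - word_map r b (i # w) v = r i * (word_map r b w u - word_map r b w v)"
    by (simp add: word_map_Cons similitude_def algebra_simps)
  then show ?case using Cons ratio_bounds(1)[of i] by (simp add: abs_mult word_ratio_def)
qed (simp add: word_map_def word_ratio_def)

lemma compact_cell: "compact (word_map r b w ` supp \<mu>)"
proof (induction w)
  case (Cons i w)
  have "word_map r b (i # w) ` supp \<mu> = similitude r b i ` (word_map r b w ` supp \<mu>)"
    by (simp add: image_image word_map_Cons)
  then show ?case using compact_continuous_image[OF continuous_similitude Cons] by simp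
qed (simp add: word_map_def compact_supp id_def)

lemma cell_subset: "set w \<subseteq> {1..N} \<Longrightarrow> word_map r b w ` supp \<mu> \<subseteq> {0..1}"
  using word_map_unit supp_subset by blast

text \<open>In the self-similarity equation for \<open>S\<^sub>i(A)\<close>, the \<open>i\<close>-th summand alone is \<open>m\<^sub>i \<mu>(A)\<close>, because \<open>S\<^sub>i\<close> is
  injective; so each letter of the word costs at most a factor \<open>m\<^sub>i > 0\<close>.\<close>

lemma cell_measure_pos: "set w \<subseteq> {1..N} \<Longrightarrow> 0 < measure \<mu> (word_map r b w ` supp \<mu>)"
proof (induction w)
  case Nil
  then show ?case by (simp add: word_map_def id_def measure_supp)
next
  case (Cons i w)
  let ?A = "word_map r b w ` supp \<mu>" and ?B = "word_map r b (i # w) ` supp \<mu>"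
  have i: "i \<in> {1..N}" and w: "set w \<subseteq> {1..N}" using Cons.prems by auto
  have B: "?B = similitude r b i ` ?A" by (simp add: image_image word_map_Cons)
  have "0 < m i * measure \<mu> ?A" using weight_pos[OF i] Cons.IH[OF w] by simp
  also have "\<dots> = m i * measure \<mu> (similitude r b i -` ?B \<inter> {0..1})"
    unfolding B similitude_vimage_image[OF i cell_subset[OF w]] ..
  also have "\<dots> \<le> (\<Sum>j=1..N. m j * measure \<mu> (similitude r b j -` ?B \<inter> {0..1}))"
    using i weight_pos by (intro member_le_sum) (auto intro!: mult_nonneg_nonneg simp: less_imp_le)
  also have "\<dots> = measure \<mu> ?B"
    by (rule measure_self_similar[OF compact_in_sets[OF compact_cell cell_subset[OF Cons.prems]], symmetric])
  finally show ?case .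
qed

text \<open>The stopping threshold is an arbitrary \<open>\<theta>\<close>, so that the first letter \<open>i\<close> of the word can be split
  off: a stopped word for a preimage of \<open>x\<close> under \<open>S\<^sub>i\<close> and the threshold \<open>\<theta> / r\<^sub>i\<close> extends by \<open>i\<close> to one
  for \<open>x\<close> and \<open>\<theta>\<close>. The exponent \<open>k\<close> bounds the number of letters needed.\<close>

lemma stopped_word_exists:
  assumes "r_max N r ^ k \<le> \<theta>" "\<theta> < 1" "x \<in> supp \<mu>"
  shows "\<exists>w. w \<noteq> [] \<and> set w \<subseteq> {1..N} \<and> word_ratio r (butlast w) > \<theta> \<and> \<theta> \<ge> word_ratio r w
    \<and> x \<in> word_map r b w ` supp \<mu>"
  using assms
proof (induction k arbitrary: \<theta> x)
  case 0
  then show ?case by simp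
next
  case (Suc k)
  obtain i x' where i: "i \<in> {1..N}" and x': "x' \<in> supp \<mu>" "x = similitude r b i x'"
    using supp_preimage[OF Suc.prems(3)] by blast
  show ?case
  proof (cases "r i \<le> \<theta>")
    case True
    have "x \<in> word_map r b [i] ` supp \<mu>" using x' by (simp add: word_map_def)
    then show ?thesis using True i Suc.prems(2)
      by (intro exI[of _ "[i]"]) (simp add: word_ratio_def)
  next
    case False
    note ri = ratio_bounds(1)[OF i]
    have "r_max N r ^ k * r i \<le> r_max N r ^ Suc k"
      using ratio_le_r_max[OF i] r_max_bounds by (simp add: mult.commute mult_right_mono)
    then have "r_max N r ^ k \<le> \<theta> / r i" using Suc.prems(1) ri by (simp add: pos_le_divide_eq)
    moreover have "\<theta> / r i < 1" using False ri by simp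
    ultimately obtain w where w: "w \<noteq> []" "set w \<subseteq> {1..N}" "word_ratio r (butlast w) > \<theta> / r i"
      "\<theta> / r i \<ge> word_ratio r w" "x' \<in> word_map r b w ` supp \<mu>"
      using Suc.IH x'(1) by blast
    have "x \<in> word_map r b (i # w) ` supp \<mu>"
      using w(5) x'(2) by (auto simp: word_map_Cons)
    moreover have "word_ratio r (butlast (i # w)) > \<theta>" "\<theta> \<ge> word_ratio r (i # w)"
      using w ri by (simp_all add: word_ratio_def field_simps)
    ultimately show ?thesis using w(2) i by (intro exI[of _ "i # w"]) simp
  qed
qed

lemma cell_nbhd_sets: "cell_nbhd N r b \<mu> n x \<in> sets \<mu>"
proof -
  have "{word_map r b w ` supp \<mu> | w. w \<in> word_partition N r n \<and> x \<in> word_map r b w ` supp \<mu>} \<subseteq> sets \<mu>"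
    using compact_in_sets[OF compact_cell cell_subset] by (auto simp: word_partition_def)
  moreover have "countable {word_map r b w ` supp \<mu> | w. w \<in> word_partition N r n \<and> x \<in> word_map r b w ` supp \<mu>}"
    by (rule countable_subset[of _ "range (\<lambda>w. word_map r b w ` supp \<mu>)"]) auto
  ultimately show ?thesis unfolding cell_nbhd_def by (rule sets.countable_Union[rotated])
qed

lemma cell_nbhd_measure_pos:
  assumes "n \<ge> 1" "x \<in> supp \<mu>"
  shows "0 < measure \<mu> (cell_nbhd N r b \<mu> n x)"
proof -
  have "r_max N r ^ n < 1"
    using r_max_bounds assms(1) by (simp add: power_less_one_iff)
  then obtain w where w: "w \<noteq> []" "set w \<subseteq> {1..N}" "word_ratio r (butlast w) > r_max N r ^ n"
    "r_max N r ^ n \<ge> word_ratio r w" "x \<in> word_map r b w ` supp \<mu>"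
    using stopped_word_exists[OF order_refl _ assms(2)] by blast
  then have "word_map r b w ` supp \<mu> \<subseteq> cell_nbhd N r b \<mu> n x"
    unfolding cell_nbhd_def word_partition_def by blast
  from finite_measure_mono[OF this cell_nbhd_sets] show ?thesis
    using cell_measure_pos[OF w(2)] by linarith
qed

lemma cell_nbhd_near:
  assumes "z \<in> cell_nbhd N r b \<mu> n x"
  shows "\<bar>z - x\<bar> \<le> r_max N r ^ n"
proof -
  obtain w u v where w: "set w \<subseteq> {1..N}" "word_ratio r w \<le> r_max N r ^ n"
    and uv: "u \<in> supp \<mu>" "v \<in> supp \<mu>" "z = word_map r b w u" "x = word_map r b w v"
    using assms unfolding cell_nbhd_def word_partition_def by blast
  have "u \<in> {0..1}" "v \<in> {0..1}" using uv(1,2) supp_subset by blast+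
  then have "\<bar>u - v\<bar> \<le> 1" by auto
  moreover have "0 \<le> word_ratio r w"
    unfolding word_ratio_def by (rule prod_list_nonneg) (use w(1) ratio_bounds in \<open>auto intro!: less_imp_le\<close>)
  ultimately have "word_ratio r w * \<bar>u - v\<bar> \<le> word_ratio r w" by (simp add: mult_left_le)
  then show ?thesis using word_map_dist[OF w(1), of u v] w(2) uv by simp
qed

end

section \<open>Convergence\<close>

theorem mainTheorem3:
  fixes N :: nat and r b m lam :: "nat \<Rightarrow> real" and \<mu> :: "real measure"
    and bc :: boundary and \<phi> :: "nat \<Rightarrow> real \<Rightarrow> real" and T :: real
  assumes "interval_ifs N r b"
    and "prob_weights N m"
    and "self_similar_measure N r b m \<mu>"
    and "eigenbasis bc \<mu> lam \<phi>"
    and "T > 0"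
    and "delta_exponent N r m + 1 < 1 / spectral_exponent N r m"
  shows "(\<exists>P. wave_propagator bc \<mu> lam \<phi> P) \<and>
    (\<forall>P. wave_propagator bc \<mu> lam \<phi> P \<longrightarrow>
      (\<forall>x\<in>supp \<mu>. \<forall>t\<in>{0..T}.
        (\<forall>n\<ge>1. integrable \<mu>
           (\<lambda>y. (L2_inner \<mu> (\<lambda>z. P t z y) (approx_delta N r b \<mu> n x) - P t x y)\<^sup>2)) \<and>
        (\<lambda>n. \<integral>y. (L2_inner \<mu> (\<lambda>z. P t z y) (approx_delta N r b \<mu> n x) - P t x y)\<^sup>2 \<partial>\<mu>)
          \<longlonglongrightarrow> 0))"
proof -
  interpret interval_measure \<mu>
    using assms(3)
    by (auto simp: self_similar_measure_def interval_measure_def interval_measure_axioms_def)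
  interpret kf_eigenbasis \<mu> bc lam \<phi>
    by unfold_locales (rule assms(4))
  interpret ifs_measure \<mu> N r b m
    by unfold_locales (rule assms(1-3))+
  have "integrable \<mu> (\<lambda>y. (L2_inner \<mu> (\<lambda>z. P t z y) (approx_delta N r b \<mu> n x) - P t x y)\<^sup>2)"
    and "(\<integral>y. (L2_inner \<mu> (\<lambda>z. P t z y) (approx_delta N r b \<mu> n x) - P t x y)\<^sup>2 \<partial>\<mu>) \<le> r_max N r ^ n"
    if P: "wave_propagator bc \<mu> lam \<phi> P" and x: "x \<in> supp \<mu>" and t: "t \<in> {0..T}" and n: "n \<ge> 1"
    for P x t n
  proof -
    let ?D = "cell_nbhd N r b \<mu> n x"
    have f: "approx_delta N r b \<mu> n x = (\<lambda>z. inverse (measure \<mu> ?D) * indicator ?D z)"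
      by (simp add: approx_delta_def fun_eq_iff)
    have t0: "t \<ge> 0" and x01: "x \<in> {0..1}" using t x supp_subset by auto
    note err = propagator_average_error[OF P t0 x01 cell_nbhd_sets cell_nbhd_measure_pos[OF n x]
        cell_nbhd_near, folded f]
    show "integrable \<mu> (\<lambda>y. (L2_inner \<mu> (\<lambda>z. P t z y) (approx_delta N r b \<mu> n x) - P t x y)\<^sup>2)"
      by (rule L2_square_integrable[OF err(1)])
    show "(\<integral>y. (L2_inner \<mu> (\<lambda>z. P t z y) (approx_delta N r b \<mu> n x) - P t x y)\<^sup>2 \<partial>\<mu>) \<le> r_max N r ^ n"
      by (rule err(2))
  qed
  note est = this
  have "(\<lambda>n. \<integral>y. (L2_inner \<mu> (\<lambda>z. P t z y) (approx_delta N r b \<mu> n x) - P t x y)\<^sup>2 \<partial>\<mu>) \<longlonglongrightarrow> 0"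
    if "wave_propagator bc \<mu> lam \<phi> P" "x \<in> supp \<mu>" "t \<in> {0..T}" for P x t
  proof (rule Lim_null_comparison)
    show "\<forall>\<^sub>F n in sequentially. norm (\<integral>y. (L2_inner \<mu> (\<lambda>z. P t z y) (approx_delta N r b \<mu> n x)
        - P t x y)\<^sup>2 \<partial>\<mu>) \<le> r_max N r ^ n"
      using eventually_ge_at_top[of 1] by eventually_elim (use est(2)[OF that] in simp)
    show "(\<lambda>n. r_max N r ^ n) \<longlonglongrightarrow> 0"
      by (rule LIMSEQ_realpow_zero) (use r_max_bounds in auto)
  qed
  then show ?thesis using wave_propagator_exists est(1) by blast
qed

end
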